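(* Let $\mathbf{C}$ be a nontrivial monoidal $\dagger$-category with simple tensor unit $I$, which has all finite $\dagger$-limits, and for which the semiring of self-adjoint scalars is Dedekind-complete. Then the involutive semiring of scalars $\mathrm{Hom}(I,I)$ has an involution-preserving (semiring) embedding into the complex numbers, where $\mathbb{C}$ carries complex conjugation as its involution.
   Context: Composition is written in diagrammatic order: $f;g$ means first $f$, then $g$. A $\dagger$-category is a category with a contravariant endofunctor $\dagger$ that is the identity on objects and satisfies $(f^\dagger)^\dagger=f$. For the present purposes a monoidal $\dagger$-category is a monoidal category (with unit object $I$) that is also a $\dagger$-category; no compatibility between the tensor and $\dagger$ is assumed. $\dagger$-limits: suppose $\mathbf{C}$ is enriched in commutative monoids, i.e. each hom-set is a commutative monoid $(+,0_{A,B})$ and composition is bilinear. A finite forest-shaped multigraph is a finite directed multigraph (possibly empty) each of whose connected components is a finite tree oriented from its leaves towards a single root, where several parallel arrows between adjacent nodes are allowed; the leaves are the objects that are not the target of any (non-identity) arrow. A finite diagram is a functor $F:\mathbf{J}\to\mathbf{C}$ with $\mathbf{J}$ the free category on such a multigraph. A $\dagger$-limit of $F$ is an ordinary limit $(L,\,l_S:L\to F(S))$ of $F$ satisfying $\sum_{S \text{ leaf of } \mathbf{J}} l_S;l_S^\dagger=\mathrm{id}_L$. $\mathbf{C}$ has all finite $\dagger$-limits if every finite diagram has a $\dagger$-limit (in which case the enrichment is unique, and $\mathbf{C}$ has a zero object whose zero morphisms are the $0_{A,B}$). The scalars are the elements of $\mathrm{Hom}(I,I)$; they form a commutative semiring with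 addition the hom-set addition, multiplication composition, and involution $a\mapsto a^\dagger$. The self-adjoint scalars are those with $a=a^\dagger$; they form a subsemiring. The tensor unit is simple if every monomorphism into $I$ is either zero or an isomorphism. Nontrivial means $0_{I,I}\neq\mathrm{id}_I$. An order on a semiring is a (reflexive) total order with $a\le b\Rightarrow a+c\le b+c$ and $0\le a,\,0\le b\Rightarrow 0\le ab$. The self-adjoint scalars are Dedekind-complete if they admit an order such that every nonempty subset with an upper bound has a least upper bound, every nonempty subset with a lower bound has a greatest lower bound, and these satisfy $\bigvee(X+r)=\bigvee(X)+r$ and $\bigwedge(X+r)=\bigwedge(X)+r$ for every element $r$, where $X+r=\{x+r\mid x\in X\}$. *)

theory Defs
  imports
    Complex_Main
    "HOL-Algebra.Ring"
    "Graph_Theory.Digraph_Component"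
    "Graph_Theory.Vertex_Walk"
begin

section \<open>Categories, functors and limits\<close>

text \<open>Composition is in diagrammatic order.\<close>

record ('o, 'm) category =
  obj :: "'o set"
  arr :: "'m set"
  source :: "'m \<Rightarrow> 'o"
  target :: "'m \<Rightarrow> 'o"
  ident :: "'o \<Rightarrow> 'm"
  seqcomp :: "'m \<Rightarrow> 'm \<Rightarrow> 'm"  (infixl \<open>\<Zsemi>\<index>\<close> 60)

definition homset :: "('o, 'm, 'z) category_scheme \<Rightarrow> 'o \<Rightarrow> 'o \<Rightarrow> 'm set" where
  "homset C A B = {f \<in> arr C. source C f = A \<and> target C f = B}"

locale category =
  fixes C :: "('o, 'm, 'z) category_scheme" (structure)
  assumes source_obj: "f \<in> arr C \<Longrightarrow> source C f \<in> obj C"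
    and target_obj: "f \<in> arr C \<Longrightarrow> target C f \<in> obj C"
    and ident_homset: "A \<in> obj C \<Longrightarrow> ident C A \<in> homset C A A"
    and seqcomp_homset: "\<lbrakk>f \<in> homset C A B; g \<in> homset C B D\<rbrakk> \<Longrightarrow> f \<Zsemi> g \<in> homset C A D"
    and ident_left: "f \<in> homset C A B \<Longrightarrow> ident C A \<Zsemi> f = f"
    and ident_right: "f \<in> homset C A B \<Longrightarrow> f \<Zsemi> ident C B = f"
    and seqcomp_assoc:
      "\<lbrakk>f \<in> homset C A B; g \<in> homset C B D; h \<in> homset C D E\<rbrakk>
        \<Longrightarrow> (f \<Zsemi> g) \<Zsemi> h = f \<Zsemi> (g \<Zsemi> h)"

definition is_mono :: "('o, 'm, 'z) category_scheme \<Rightarrow> 'm \<Rightarrow> bool" where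
  "is_mono C f \<longleftrightarrow> f \<in> arr C \<and>
    (\<forall>A \<in> obj C. \<forall>g \<in> homset C A (source C f). \<forall>h \<in> homset C A (source C f).
      g \<Zsemi>\<^bsub>C\<^esub> f = h \<Zsemi>\<^bsub>C\<^esub> f \<longrightarrow> g = h)"

definition is_iso :: "('o, 'm, 'z) category_scheme \<Rightarrow> 'm \<Rightarrow> bool" where
  "is_iso C f \<longleftrightarrow> f \<in> arr C \<and>
    (\<exists>g \<in> homset C (target C f) (source C f).
      f \<Zsemi>\<^bsub>C\<^esub> g = ident C (source C f) \<and> g \<Zsemi>\<^bsub>C\<^esub> f = ident C (target C f))"

definition is_functor ::
  "('a, 'b, 'y) category_scheme \<Rightarrow> ('o, 'm, 'z) category_scheme \<Rightarrow> ('a \<Rightarrow> 'o) \<Rightarrow> ('b \<Rightarrow> 'm) \<Rightarrow> bool"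
where
  "is_functor J C Fo Fa \<longleftrightarrow>
    (\<forall>S \<in> obj J. Fo S \<in> obj C) \<and>
    (\<forall>f \<in> arr J. Fa f \<in> homset C (Fo (source J f)) (Fo (target J f))) \<and>
    (\<forall>S \<in> obj J. Fa (ident J S) = ident C (Fo S)) \<and>
    (\<forall>f \<in> arr J. \<forall>g \<in> arr J. target J f = source J g \<longrightarrow> Fa (f \<Zsemi>\<^bsub>J\<^esub> g) = Fa f \<Zsemi>\<^bsub>C\<^esub> Fa g)"

definition is_cone ::
  "('a, 'b, 'y) category_scheme \<Rightarrow> ('o, 'm, 'z) category_scheme \<Rightarrow> ('a \<Rightarrow> 'o) \<Rightarrow> ('b \<Rightarrow> 'm)
    \<Rightarrow> 'o \<Rightarrow> ('a \<Rightarrow> 'm) \<Rightarrow> bool"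
where
  "is_cone J C Fo Fa L l \<longleftrightarrow>
    L \<in> obj C \<and>
    (\<forall>S \<in> obj J. l S \<in> homset C L (Fo S)) \<and>
    (\<forall>f \<in> arr J. l (source J f) \<Zsemi>\<^bsub>C\<^esub> Fa f = l (target J f))"

definition is_limit ::
  "('a, 'b, 'y) category_scheme \<Rightarrow> ('o, 'm, 'z) category_scheme \<Rightarrow> ('a \<Rightarrow> 'o) \<Rightarrow> ('b \<Rightarrow> 'm)
    \<Rightarrow> 'o \<Rightarrow> ('a \<Rightarrow> 'm) \<Rightarrow> bool"
where
  "is_limit J C Fo Fa L l \<longleftrightarrow>
    is_cone J C Fo Fa L l \<and>
    (\<forall>M m. is_cone J C Fo Fa M m \<longrightarrow>
      (\<exists>!u. u \<in> homset C M L \<and> (\<forall>S \<in> obj J. u \<Zsemi>\<^bsub>C\<^esub> l S = m S)))"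


section \<open>Dagger, enrichment and tensor\<close>

record ('o, 'm) dagger_category = "('o, 'm) category" +
  dagger :: "'m \<Rightarrow> 'm"

locale dagger_category = category C
  for C :: "('o, 'm, 'z) dagger_category_scheme" (structure) +
  assumes dagger_homset: "f \<in> homset C A B \<Longrightarrow> dagger C f \<in> homset C B A"
    and dagger_ident: "A \<in> obj C \<Longrightarrow> dagger C (ident C A) = ident C A"
    and dagger_seqcomp:
      "\<lbrakk>f \<in> homset C A B; g \<in> homset C B D\<rbrakk> \<Longrightarrow> dagger C (f \<Zsemi> g) = dagger C g \<Zsemi> dagger C f"
    and dagger_dagger: "f \<in> arr C \<Longrightarrow> dagger C (dagger C f) = f"

text \<open>
  Arrows determine their source and target, so a single operation \<open>hom_add\<close> carries the
  additions of all the hom-sets; its values on non-parallel arrows are irrelevant.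
  No compatibility between addition and dagger is required.
\<close>

record ('o, 'm) cmon_dagger_category = "('o, 'm) dagger_category" +
  hom_zero :: "'o \<Rightarrow> 'o \<Rightarrow> 'm"
  hom_add :: "'m \<Rightarrow> 'm \<Rightarrow> 'm"  (infixl \<open>\<boxplus>\<index>\<close> 55)

definition hom_monoid ::
  "('o, 'm, 'z) cmon_dagger_category_scheme \<Rightarrow> 'o \<Rightarrow> 'o \<Rightarrow> 'm monoid"
where
  "hom_monoid C A B = \<lparr>carrier = homset C A B, monoid.mult = hom_add C, one = hom_zero C A B\<rparr>"

locale cmon_enriched = category C
  for C :: "('o, 'm, 'z) cmon_dagger_category_scheme" (structure) +
  assumes hom_comm_monoid: "\<lbrakk>A \<in> obj C; B \<in> obj C\<rbrakk> \<Longrightarrow> comm_monoid (hom_monoid C A B)"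
    and add_seqcomp:
      "\<lbrakk>f \<in> homset C A B; g \<in> homset C A B; h \<in> homset C B D\<rbrakk>
        \<Longrightarrow> (f \<boxplus> g) \<Zsemi> h = (f \<Zsemi> h) \<boxplus> (g \<Zsemi> h)"
    and seqcomp_add:
      "\<lbrakk>f \<in> homset C A B; g \<in> homset C B D; h \<in> homset C B D\<rbrakk>
        \<Longrightarrow> f \<Zsemi> (g \<boxplus> h) = (f \<Zsemi> g) \<boxplus> (f \<Zsemi> h)"
    and zero_seqcomp:
      "\<lbrakk>A \<in> obj C; h \<in> homset C B D\<rbrakk> \<Longrightarrow> hom_zero C A B \<Zsemi> h = hom_zero C A D"
    and seqcomp_zero:
      "\<lbrakk>D \<in> obj C; f \<in> homset C A B\<rbrakk> \<Longrightarrow> f \<Zsemi> hom_zero C B D = hom_zero C A D"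

text \<open>
  The components of the structure isomorphisms are
  \<open>associator C A B D : (A \<otimes> B) \<otimes> D \<rightarrow> A \<otimes> (B \<otimes> D)\<close>,
  \<open>left_unitor C A : I \<otimes> A \<rightarrow> A\<close> and \<open>right_unitor C A : A \<otimes> I \<rightarrow> A\<close>.
  They need not be unitary, and the tensor need not preserve the dagger or the addition.
\<close>

record ('o, 'm) monoidal_dagger_category = "('o, 'm) cmon_dagger_category" +
  unit_obj :: 'o
  tensor_obj :: "'o \<Rightarrow> 'o \<Rightarrow> 'o"  (infixl \<open>\<otimes>\<^sub>o\<index>\<close> 70)
  tensor_arr :: "'m \<Rightarrow> 'm \<Rightarrow> 'm"  (infixl \<open>\<otimes>\<^sub>a\<index>\<close> 70)
  associator :: "'o \<Rightarrow> 'o \<Rightarrow> 'o \<Rightarrow> 'm"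
  left_unitor :: "'o \<Rightarrow> 'm"
  right_unitor :: "'o \<Rightarrow> 'm"

locale monoidal_category = category C
  for C :: "('o, 'm, 'z) monoidal_dagger_category_scheme" (structure) +
  assumes unit_obj: "unit_obj C \<in> obj C"
    and tensor_obj: "\<lbrakk>A \<in> obj C; B \<in> obj C\<rbrakk> \<Longrightarrow> A \<otimes>\<^sub>o B \<in> obj C"
    and tensor_homset:
      "\<lbrakk>f \<in> homset C A A'; g \<in> homset C B B'\<rbrakk> \<Longrightarrow> f \<otimes>\<^sub>a g \<in> homset C (A \<otimes>\<^sub>o B) (A' \<otimes>\<^sub>o B')"
    and tensor_ident:
      "\<lbrakk>A \<in> obj C; B \<in> obj C\<rbrakk> \<Longrightarrow> ident C A \<otimes>\<^sub>a ident C B = ident C (A \<otimes>\<^sub>o B)"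
    and tensor_seqcomp:
      "\<lbrakk>f \<in> homset C A A'; f' \<in> homset C A' A''; g \<in> homset C B B'; g' \<in> homset C B' B''\<rbrakk>
        \<Longrightarrow> (f \<Zsemi> f') \<otimes>\<^sub>a (g \<Zsemi> g') = (f \<otimes>\<^sub>a g) \<Zsemi> (f' \<otimes>\<^sub>a g')"
    and associator_homset:
      "\<lbrakk>A \<in> obj C; B \<in> obj C; D \<in> obj C\<rbrakk>
        \<Longrightarrow> associator C A B D \<in> homset C ((A \<otimes>\<^sub>o B) \<otimes>\<^sub>o D) (A \<otimes>\<^sub>o (B \<otimes>\<^sub>o D))"
    and associator_iso:
      "\<lbrakk>A \<in> obj C; B \<in> obj C; D \<in> obj C\<rbrakk> \<Longrightarrow> is_iso C (associator C A B D)"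
    and associator_natural:
      "\<lbrakk>f \<in> homset C A A'; g \<in> homset C B B'; h \<in> homset C D D'\<rbrakk>
        \<Longrightarrow> ((f \<otimes>\<^sub>a g) \<otimes>\<^sub>a h) \<Zsemi> associator C A' B' D'
          = associator C A B D \<Zsemi> (f \<otimes>\<^sub>a (g \<otimes>\<^sub>a h))"
    and left_unitor_homset: "A \<in> obj C \<Longrightarrow> left_unitor C A \<in> homset C (unit_obj C \<otimes>\<^sub>o A) A"
    and left_unitor_iso: "A \<in> obj C \<Longrightarrow> is_iso C (left_unitor C A)"
    and left_unitor_natural:
      "f \<in> homset C A B
        \<Longrightarrow> (ident C (unit_obj C) \<otimes>\<^sub>a f) \<Zsemi> left_unitor C B = left_unitor C A \<Zsemi> f"
    and right_unitor_homset: "A \<in> obj C \<Longrightarrow> right_unitor C A \<in> homset C (A \<otimes>\<^sub>o unit_obj C) A"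
    and right_unitor_iso: "A \<in> obj C \<Longrightarrow> is_iso C (right_unitor C A)"
    and right_unitor_natural:
      "f \<in> homset C A B
        \<Longrightarrow> (f \<otimes>\<^sub>a ident C (unit_obj C)) \<Zsemi> right_unitor C B = right_unitor C A \<Zsemi> f"
    and pentagon:
      "\<lbrakk>A \<in> obj C; B \<in> obj C; D \<in> obj C; E \<in> obj C\<rbrakk>
        \<Longrightarrow> associator C (A \<otimes>\<^sub>o B) D E \<Zsemi> associator C A B (D \<otimes>\<^sub>o E)
          = (associator C A B D \<otimes>\<^sub>a ident C E) \<Zsemi> associator C A (B \<otimes>\<^sub>o D) E
            \<Zsemi> (ident C A \<otimes>\<^sub>a associator C B D E)"
    and triangle:
      "\<lbrakk>A \<in> obj C; B \<in> obj C\<rbrakk>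
        \<Longrightarrow> associator C A (unit_obj C) B \<Zsemi> (ident C A \<otimes>\<^sub>a left_unitor C B)
          = right_unitor C A \<otimes>\<^sub>a ident C B"


section \<open>Finite dagger limits\<close>

text \<open>The arrows of the free category on a multigraph are its finite walks \<open>(u, p, v)\<close>.\<close>

definition free_category ::
  "('v, 'e) pre_digraph \<Rightarrow> ('v, 'v \<times> 'e list \<times> 'v) category"
where
  "free_category G =
    \<lparr>obj = verts G,
     arr = {(u, p, v). pre_digraph.awalk G u p v},
     source = (\<lambda>(u, p, v). u),
     target = (\<lambda>(u, p, v). v),
     ident = (\<lambda>v. (v, [], v)),
     seqcomp = (\<lambda>(u, p, v) (v', q, w). (u, p @ q, w))\<rparr>"

text \<open>
  \<open>r\<close> is the root of a tree, all of whose edges point towards \<open>r\<close>, iff every vertex has exactly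
  one directed walk to \<open>r\<close>.  Walks are lists of vertices, so parallel arrows count as one edge.
\<close>

definition in_tree :: "('v, 'e) pre_digraph \<Rightarrow> bool" where
  "in_tree G \<longleftrightarrow>
    (\<exists>r \<in> verts G. \<forall>v \<in> verts G. \<exists>!p. vwalk p G \<and> hd p = v \<and> last p = r)"

text \<open>The connected components are the maximal connected subgraphs.\<close>

definition forest_shaped :: "('v, 'e) pre_digraph \<Rightarrow> bool" where
  "forest_shaped G \<longleftrightarrow>
    fin_digraph G \<and>
    (\<forall>K. pre_digraph.max_subgraph G Digraph_Component.connected K \<longrightarrow> in_tree K)"

definition leaves :: "('a, 'b, 'y) category_scheme \<Rightarrow> 'a set" where
  "leaves J = {S \<in> obj J. \<forall>f \<in> arr J. target J f = S \<longrightarrow> f = ident J S}"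

text \<open>The sum over the leaves is a \<^const>\<open>finprod\<close> in the commutative monoid of endomorphisms.\<close>

definition is_dagger_limit ::
  "('a, 'b, 'y) category_scheme \<Rightarrow> ('o, 'm, 'z) cmon_dagger_category_scheme
    \<Rightarrow> ('a \<Rightarrow> 'o) \<Rightarrow> ('b \<Rightarrow> 'm) \<Rightarrow> 'o \<Rightarrow> ('a \<Rightarrow> 'm) \<Rightarrow> bool"
where
  "is_dagger_limit J C Fo Fa L l \<longleftrightarrow>
    is_limit J C Fo Fa L l \<and>
    finprod (hom_monoid C L L) (\<lambda>S. l S \<Zsemi>\<^bsub>C\<^esub> dagger C (l S)) (leaves J) = ident C L"

text \<open>
  Every finite multigraph is isomorphic to one whose vertices and arrows are natural numbers,
  so it is no restriction to consider only these.
\<close>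

definition has_finite_dagger_limits :: "('o, 'm, 'z) cmon_dagger_category_scheme \<Rightarrow> bool" where
  "has_finite_dagger_limits C \<longleftrightarrow>
    (\<forall>(G :: (nat, nat) pre_digraph) Fo Fa.
      forest_shaped G \<and> is_functor (free_category G) C Fo Fa \<longrightarrow>
      (\<exists>L l. is_dagger_limit (free_category G) C Fo Fa L l))"


section \<open>Scalars\<close>

definition scalars :: "('o, 'm, 'z) monoidal_dagger_category_scheme \<Rightarrow> 'm ring" where
  "scalars C =
    \<lparr>carrier = homset C (unit_obj C) (unit_obj C),
     monoid.mult = seqcomp C,
     one = ident C (unit_obj C),
     zero = hom_zero C (unit_obj C) (unit_obj C),
     add = hom_add C\<rparr>"

definition self_adjoint_scalars :: "('o, 'm, 'z) monoidal_dagger_category_scheme \<Rightarrow> 'm ring" where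
  "self_adjoint_scalars C =
    (scalars C)\<lparr>carrier := {a \<in> homset C (unit_obj C) (unit_obj C). dagger C a = a}\<rparr>"

definition simple_unit :: "('o, 'm, 'z) monoidal_dagger_category_scheme \<Rightarrow> bool" where
  "simple_unit C \<longleftrightarrow>
    (\<forall>f. is_mono C f \<and> target C f = unit_obj C \<longrightarrow>
      f = hom_zero C (source C f) (unit_obj C) \<or> is_iso C f)"

definition semiring_order :: "('a, 'b) ring_scheme \<Rightarrow> 'a rel \<Rightarrow> bool" where
  "semiring_order R leq \<longleftrightarrow>
    linear_order_on (carrier R) leq \<and>
    (\<forall>a \<in> carrier R. \<forall>b \<in> carrier R. \<forall>c \<in> carrier R.
      (a, b) \<in> leq \<longrightarrow> (a \<oplus>\<^bsub>R\<^esub> c, b \<oplus>\<^bsub>R\<^esub> c) \<in> leq) \<and>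
    (\<forall>a \<in> carrier R. \<forall>b \<in> carrier R.
      (\<zero>\<^bsub>R\<^esub>, a) \<in> leq \<and> (\<zero>\<^bsub>R\<^esub>, b) \<in> leq \<longrightarrow> (\<zero>\<^bsub>R\<^esub>, a \<otimes>\<^bsub>R\<^esub> b) \<in> leq)"

definition upper_bound_in :: "'a set \<Rightarrow> 'a rel \<Rightarrow> 'a set \<Rightarrow> 'a \<Rightarrow> bool" where
  "upper_bound_in A leq X u \<longleftrightarrow> u \<in> A \<and> (\<forall>x \<in> X. (x, u) \<in> leq)"

definition lub_in :: "'a set \<Rightarrow> 'a rel \<Rightarrow> 'a set \<Rightarrow> 'a \<Rightarrow> bool" where
  "lub_in A leq X s \<longleftrightarrow>
    upper_bound_in A leq X s \<and> (\<forall>u. upper_bound_in A leq X u \<longrightarrow> (s, u) \<in> leq)"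

text \<open>The least-upper-bound half of Dedekind-completeness; the greatest-lower-bound half is the
  same condition for the converse relation.\<close>

definition translation_bounded_complete :: "('a, 'b) ring_scheme \<Rightarrow> 'a rel \<Rightarrow> bool" where
  "translation_bounded_complete R leq \<longleftrightarrow>
    (\<forall>X. X \<subseteq> carrier R \<and> X \<noteq> {} \<and> (\<exists>u. upper_bound_in (carrier R) leq X u) \<longrightarrow>
      (\<exists>s. lub_in (carrier R) leq X s \<and>
        (\<forall>r \<in> carrier R. lub_in (carrier R) leq ((\<lambda>x. x \<oplus>\<^bsub>R\<^esub> r) ` X) (s \<oplus>\<^bsub>R\<^esub> r))))"

definition dedekind_complete :: "('a, 'b) ring_scheme \<Rightarrow> bool" where
  "dedekind_complete R \<longleftrightarrow>
    (\<exists>leq. semiring_order R leq \<and>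
      translation_bounded_complete R leq \<and> translation_bounded_complete R (leq\<inverse>))"

definition involutive_embedding_into_complex ::
  "('a, 'b) ring_scheme \<Rightarrow> ('a \<Rightarrow> 'a) \<Rightarrow> ('a \<Rightarrow> complex) \<Rightarrow> bool"
where
  "involutive_embedding_into_complex R star \<phi> \<longleftrightarrow>
    inj_on \<phi> (carrier R) \<and>
    \<phi> \<zero>\<^bsub>R\<^esub> = 0 \<and>
    \<phi> \<one>\<^bsub>R\<^esub> = 1 \<and>
    (\<forall>a \<in> carrier R. \<forall>b \<in> carrier R. \<phi> (a \<oplus>\<^bsub>R\<^esub> b) = \<phi> a + \<phi> b) \<and>
    (\<forall>a \<in> carrier R. \<forall>b \<in> carrier R. \<phi> (a \<otimes>\<^bsub>R\<^esub> b) = \<phi> a * \<phi> b) \<and>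
    (\<forall>a \<in> carrier R. \<phi> (star a) = cnj (\<phi> a))"

end

theory Submission
  imports Defs
begin

text \<open>
  Only dagger limits of discrete pairs and of parallel pairs are used: dagger biproducts
  \<open>A \<oplus> A\<close> and dagger equalizers.  An equalizer \<open>e\<close> yields a self-adjoint idempotent
  \<open>P = e\<^sup>\<dagger> e\<close>, and writing \<open>P\<close> on \<open>A \<oplus> A\<close> as a matrix shows that addition is cancellative, and that
  \<open>a c + b d = a d + b c\<close> forces \<open>a = b\<close> or \<open>c = d\<close> for scalars; hence the difference ring of the
  scalars is a domain.  Simplicity of the unit makes nonzero scalars invertible.

  On self-adjoint scalars, suprema commuting with translations make the order Archimedean and
  yield differences \<open>y - x \<ge> 0\<close> whenever \<open>x \<le> y\<close>.  Rational cuts then embed them into the reals,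
  with all nonnegative reals in the image.  If some \<open>s\<close> is not self-adjoint, then
  \<open>(s - s\<^sup>\<dagger>)\<^sup>2\<close> is negative in the difference ring, so \<open>s - s\<^sup>\<dagger>\<close> can be normalised to a square root
  of \<open>-1\<close>, over which every scalar splits into a real and an imaginary part.
\<close>

text \<open>Scalars need not have additive inverses at the outset, so the difference ring stays
  implicit: its equations are written with negative terms moved to the other side, and cancellation
  replaces subtraction. The projection \<open>P\<close> compensates for the missing negatives. A row
  equalizes two arrows exactly when \<open>P\<close> fixes it, and self-adjointness turns each
  off-diagonal entry into the dagger of the other. Two known fixed rows then pin down the matrix:
  the diagonal and one injection for cancellation; the diagonal and \<open>(c, d)\<close>, helped by
  idempotency, for the product law.

  The order axioms are weak too: they ask neither that one be nonnegative nor that multiplication be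
  monotone, and the nonnegative reals with reversed order satisfy them. Hence the role of
  nonnegative differences, which yield monotonicity, and the case distinction on the sign of one.
  Reaching every nonnegative real, beyond mere injectivity, matters because the imaginary unit is
  built with square roots.\<close>

no_notation vwalk_join (infixr "\<oplus>" 65)

section \<open>Complete ordered semifields\<close>

locale cancel_semifield = semiring R + comm_monoid R for R (structure) +
  assumes add_cancel:
      "\<lbrakk>a \<oplus> c = b \<oplus> c; a \<in> carrier R; b \<in> carrier R; c \<in> carrier R\<rbrakk> \<Longrightarrow> a = b"
    and inverse_exists: "\<lbrakk>a \<in> carrier R; a \<noteq> \<zero>\<rbrakk> \<Longrightarrow> \<exists>b\<in>carrier R. a \<otimes> b = \<one>"
    and zero_neq_one: "\<zero> \<noteq> \<one>"
begin

lemma add_left_cancel: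
  assumes "c \<oplus> a = c \<oplus> b" "a \<in> carrier R" "b \<in> carrier R" "c \<in> carrier R"
  shows "a = b"
  using add_cancel[of a c b] assms by (simp add: a_comm)

lemma mult_left_cancel:
  assumes "a \<otimes> b = a \<otimes> c" "a \<noteq> \<zero>" "a \<in> carrier R" "b \<in> carrier R" "c \<in> carrier R"
  shows "b = c"
proof -
  obtain d where d: "d \<in> carrier R" "a \<otimes> d = \<one>"
    using inverse_exists assms by blast
  have "b = (d \<otimes> a) \<otimes> b" using d assms by (simp add: m_comm)
  also have "\<dots> = (d \<otimes> a) \<otimes> c" using d assms by (simp add: m_assoc)
  also have "\<dots> = c" using d assms by (simp add: m_comm)
  finally show ?thesis .
qed

end

section \<open>Order, suprema and differences\<close>

locale complete_ordered_semifield = cancel_semifield R for R (structure) +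
  fixes leq :: "'a rel"
  assumes order: "semiring_order R leq"
    and complete: "translation_bounded_complete R leq"
    and complete_dual: "translation_bounded_complete R (leq\<inverse>)"
begin

definition le :: "'a \<Rightarrow> 'a \<Rightarrow> bool" (infix "\<preceq>" 50) where
  "x \<preceq> y \<longleftrightarrow> (x, y) \<in> leq"

definition lt :: "'a \<Rightarrow> 'a \<Rightarrow> bool" (infix "\<prec>" 50) where
  "x \<prec> y \<longleftrightarrow> x \<in> carrier R \<and> y \<in> carrier R \<and> \<not> y \<preceq> x"

lemma
  shows le_refl: "x \<in> carrier R \<Longrightarrow> x \<preceq> x"
    and le_antisym: "\<lbrakk>x \<preceq> y; y \<preceq> x\<rbrakk> \<Longrightarrow> x = y"
    and le_trans: "\<lbrakk>x \<preceq> y; y \<preceq> z\<rbrakk> \<Longrightarrow> x \<preceq> z"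
    and le_total: "\<lbrakk>x \<in> carrier R; y \<in> carrier R\<rbrakk> \<Longrightarrow> x \<preceq> y \<or> y \<preceq> x"
    and add_mono: "\<lbrakk>x \<preceq> y; x \<in> carrier R; y \<in> carrier R; z \<in> carrier R\<rbrakk> \<Longrightarrow> x \<oplus> z \<preceq> y \<oplus> z"
    and mult_nonneg: "\<lbrakk>\<zero> \<preceq> x; \<zero> \<preceq> y; x \<in> carrier R; y \<in> carrier R\<rbrakk> \<Longrightarrow> \<zero> \<preceq> x \<otimes> y"
proof -
  have lin: "linear_order_on (carrier R) leq" using order by (simp add: semiring_order_def)
  show "x \<in> carrier R \<Longrightarrow> x \<preceq> x"
    using lin by (auto simp: le_def linear_order_on_def partial_order_on_def preorder_on_def refl_on_def)
  show "\<lbrakk>x \<preceq> y; y \<preceq> x\<rbrakk> \<Longrightarrow> x = y"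
    using lin unfolding le_def linear_order_on_def partial_order_on_def antisym_def by blast
  show "\<lbrakk>x \<preceq> y; y \<preceq> z\<rbrakk> \<Longrightarrow> x \<preceq> z"
    using lin unfolding le_def linear_order_on_def partial_order_on_def preorder_on_def trans_def by blast
  show "\<lbrakk>x \<in> carrier R; y \<in> carrier R\<rbrakk> \<Longrightarrow> x \<preceq> y \<or> y \<preceq> x"
    using lin unfolding le_def linear_order_on_def partial_order_on_def preorder_on_def refl_on_def total_on_def
    by (cases "x = y") auto
  show "\<lbrakk>x \<preceq> y; x \<in> carrier R; y \<in> carrier R; z \<in> carrier R\<rbrakk> \<Longrightarrow> x \<oplus> z \<preceq> y \<oplus> z"
    using order unfolding le_def semiring_order_def by blast
  show "\<lbrakk>\<zero> \<preceq> x; \<zero> \<preceq> y; x \<in> carrier R; y \<in> carrier R\<rbrakk> \<Longrightarrow> \<zero> \<preceq> x \<otimes> y"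
    using order unfolding le_def semiring_order_def by blast
qed

lemma lt_carrier: "x \<prec> y \<Longrightarrow> x \<in> carrier R" "x \<prec> y \<Longrightarrow> y \<in> carrier R"
  by (auto simp: lt_def)

lemma lt_imp_le: "x \<prec> y \<Longrightarrow> x \<preceq> y"
  unfolding lt_def using le_total by blast

lemma not_le: "\<lbrakk>x \<in> carrier R; y \<in> carrier R\<rbrakk> \<Longrightarrow> \<not> x \<preceq> y \<longleftrightarrow> y \<prec> x"
  by (auto simp: lt_def)

lemma lt_iff: "\<lbrakk>x \<in> carrier R; y \<in> carrier R\<rbrakk> \<Longrightarrow> x \<prec> y \<longleftrightarrow> x \<preceq> y \<and> x \<noteq> y"
  unfolding lt_def using le_total le_antisym le_refl by blast

lemma add_le_cancel:
  assumes "x \<in> carrier R" "y \<in> carrier R" "z \<in> carrier R"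
  shows "x \<oplus> z \<preceq> y \<oplus> z \<longleftrightarrow> x \<preceq> y"
proof
  assume le: "x \<oplus> z \<preceq> y \<oplus> z"
  show "x \<preceq> y"
  proof (rule ccontr)
    assume "\<not> x \<preceq> y"
    then have "y \<prec> x" using not_le assms by simp
    then have "y \<oplus> z \<preceq> x \<oplus> z" using add_mono lt_imp_le assms by blast
    then have "x = y" using le le_antisym add_cancel assms by blast
    then show False using \<open>\<not> x \<preceq> y\<close> le_refl assms by blast
  qed
qed (use add_mono assms in blast)

lemma add_le_cancel_left:
  assumes "x \<in> carrier R" "y \<in> carrier R" "z \<in> carrier R"
  shows "z \<oplus> x \<preceq> z \<oplus> y \<longleftrightarrow> x \<preceq> y"
  using add_le_cancel[OF assms] assms by (simp add: a_comm)

lemma add_mono2: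
  assumes "x \<preceq> y" "u \<preceq> v" "x \<in> carrier R" "y \<in> carrier R" "u \<in> carrier R" "v \<in> carrier R"
  shows "x \<oplus> u \<preceq> y \<oplus> v"
proof (rule le_trans)
  show "x \<oplus> u \<preceq> y \<oplus> u" using add_mono assms by simp
  show "y \<oplus> u \<preceq> y \<oplus> v" using add_le_cancel_left assms by simp
qed

lemma le_add_left: "\<lbrakk>x \<in> carrier R; z \<in> carrier R; \<zero> \<preceq> z\<rbrakk> \<Longrightarrow> x \<preceq> x \<oplus> z"
  using add_le_cancel_left[of \<zero> z x] by simp

text \<open>The last property merges leastness with translation: \<open>s \<oplus> r\<close> is
  below every upper bound of the translate of \<open>X\<close> by \<open>r\<close>. Taking
  \<open>r\<close> to be zero gives plain leastness.\<close>

lemma sup_exists: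
  assumes "X \<subseteq> carrier R" "X \<noteq> {}" "u \<in> carrier R" "\<And>x. x \<in> X \<Longrightarrow> x \<preceq> u"
  obtains s where "s \<in> carrier R" "\<And>x. x \<in> X \<Longrightarrow> x \<preceq> s"
    "\<And>r v. \<lbrakk>r \<in> carrier R; v \<in> carrier R; \<And>x. x \<in> X \<Longrightarrow> x \<oplus> r \<preceq> v\<rbrakk> \<Longrightarrow> s \<oplus> r \<preceq> v"
proof -
  have "\<exists>u. upper_bound_in (carrier R) leq X u"
    using assms by (auto simp: upper_bound_in_def le_def)
  then obtain s where s: "lub_in (carrier R) leq X s"
    and t: "\<And>r. r \<in> carrier R \<Longrightarrow> lub_in (carrier R) leq ((\<lambda>x. x \<oplus> r) ` X) (s \<oplus> r)"
    using complete assms(1,2) unfolding translation_bounded_complete_def by meson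
  show ?thesis
  proof (rule that[of s])
    show "s \<in> carrier R" "\<And>x. x \<in> X \<Longrightarrow> x \<preceq> s"
      using s by (auto simp: lub_in_def upper_bound_in_def le_def)
    show "s \<oplus> r \<preceq> v" if "r \<in> carrier R" "v \<in> carrier R" "\<And>x. x \<in> X \<Longrightarrow> x \<oplus> r \<preceq> v" for r v
      using t[OF that(1)] that(2,3) by (auto simp: lub_in_def upper_bound_in_def le_def)
  qed
qed

lemma inf_exists:
  assumes "X \<subseteq> carrier R" "X \<noteq> {}" "u \<in> carrier R" "\<And>x. x \<in> X \<Longrightarrow> u \<preceq> x"
  obtains s where "s \<in> carrier R" "\<And>x. x \<in> X \<Longrightarrow> s \<preceq> x"
    "\<And>r v. \<lbrakk>r \<in> carrier R; v \<in> carrier R; \<And>x. x \<in> X \<Longrightarrow> v \<preceq> x \<oplus> r\<rbrakk> \<Longrightarrow> v \<preceq> s \<oplus> r"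
proof -
  have "\<exists>u. upper_bound_in (carrier R) (leq\<inverse>) X u"
    using assms by (auto simp: upper_bound_in_def le_def)
  then obtain s where s: "lub_in (carrier R) (leq\<inverse>) X s"
    and t: "\<And>r. r \<in> carrier R \<Longrightarrow> lub_in (carrier R) (leq\<inverse>) ((\<lambda>x. x \<oplus> r) ` X) (s \<oplus> r)"
    using complete_dual assms(1,2) unfolding translation_bounded_complete_def by meson
  show ?thesis
  proof (rule that[of s])
    show "s \<in> carrier R" "\<And>x. x \<in> X \<Longrightarrow> s \<preceq> x"
      using s by (auto simp: lub_in_def upper_bound_in_def le_def)
    show "v \<preceq> s \<oplus> r" if "r \<in> carrier R" "v \<in> carrier R" "\<And>x. x \<in> X \<Longrightarrow> v \<preceq> x \<oplus> r" for r v
      using t[OF that(1)] that(2,3) by (auto simp: lub_in_def upper_bound_in_def le_def)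
  qed
qed

text \<open>If all \<open>x \<oplus> [m] \<cdot> a\<close> stayed below \<open>y\<close>, their
  supremum \<open>s\<close> would satisfy \<open>s \<oplus> a \<preceq> s\<close>, because adding
  \<open>a\<close> maps the progression into itself. The start \<open>x\<close> is arbitrary since
  it cannot be subtracted from both sides.\<close>

lemma archimedean:
  assumes "\<zero> \<prec> a" "x \<in> carrier R" "y \<in> carrier R"
  obtains m :: nat where "y \<prec> x \<oplus> [m] \<cdot> a"
proof (rule ccontr)
  assume "\<not> thesis"
  note a = lt_carrier[OF assms(1)]
  have b: "x \<oplus> [m] \<cdot> a \<preceq> y" for m :: nat
  proof (rule ccontr)
    assume "\<not> x \<oplus> [m] \<cdot> a \<preceq> y"
    then have "y \<prec> x \<oplus> [m] \<cdot> a" using not_le assms a by simp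
    then show False using \<open>\<not> thesis\<close> that by blast
  qed
  define X where "X = range (\<lambda>m::nat. x \<oplus> [m] \<cdot> a)"
  obtain s where s: "s \<in> carrier R" "\<And>x. x \<in> X \<Longrightarrow> x \<preceq> s"
    and t: "\<And>r v. \<lbrakk>r \<in> carrier R; v \<in> carrier R; \<And>x. x \<in> X \<Longrightarrow> x \<oplus> r \<preceq> v\<rbrakk> \<Longrightarrow> s \<oplus> r \<preceq> v"
    by (rule sup_exists[of X y]) (use a b assms in \<open>auto simp: X_def\<close>)
  have "s \<oplus> a \<preceq> s"
  proof (rule t)
    fix z assume "z \<in> X"
    then obtain m :: nat where "z = x \<oplus> [m] \<cdot> a" by (auto simp: X_def)
    then have "z \<oplus> a = x \<oplus> [Suc m] \<cdot> a"
      using a assms by (simp add: a_assoc)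
    then show "z \<oplus> a \<preceq> s" using s(2)[of "x \<oplus> [Suc m] \<cdot> a"] unfolding X_def by (metis rangeI)
  qed (use a s in auto)
  then have "a \<preceq> \<zero>" using add_le_cancel_left[of a \<zero> s] a s by simp
  then show False using assms(1) by (auto simp: lt_def)
qed

text \<open>Were one plus one zero, adding one to either comparison of zero and one would give the
  opposite comparison.\<close>

lemma two_neq_zero: "\<one> \<oplus> \<one> \<noteq> \<zero>"
proof
  assume z: "\<one> \<oplus> \<one> = \<zero>"
  have "\<one> \<preceq> \<zero> \<or> \<zero> \<preceq> \<one>" using le_total by simp
  then have "\<one> \<preceq> \<zero> \<and> \<zero> \<preceq> \<one>"
    using add_le_cancel[of \<one> \<zero> \<one>] add_le_cancel[of \<zero> \<one> \<one>] z by auto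
  then show False using le_antisym zero_neq_one by blast
qed

lemma half_exists:
  assumes "a \<in> carrier R"
  obtains b where "b \<in> carrier R" "b \<oplus> b = a"
proof -
  obtain h where h: "h \<in> carrier R" "(\<one> \<oplus> \<one>) \<otimes> h = \<one>"
    using inverse_exists two_neq_zero by blast
  then have "h \<oplus> h = \<one>" by (simp add: l_distr)
  then have "h \<otimes> a \<oplus> h \<otimes> a = a" using h assms by (simp flip: l_distr)
  then show ?thesis using that h assms by blast
qed

lemma positive_half_exists:
  assumes "\<zero> \<prec> a"
  obtains b where "\<zero> \<prec> b" "b \<oplus> b = a"
proof -
  obtain b where b: "b \<in> carrier R" "b \<oplus> b = a"
    by (rule half_exists[OF lt_carrier(2)[OF assms]])
  have "\<not> b \<preceq> \<zero>"
  proof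
    assume "b \<preceq> \<zero>"
    then have "b \<oplus> b \<preceq> \<zero> \<oplus> \<zero>" using add_mono2 b by blast
    then show False using b assms by (simp add: lt_def)
  qed
  then show ?thesis using that b not_le by blast
qed

text \<open>The infimum \<open>t\<close> of the positive elements satisfies \<open>t \<oplus> t \<preceq> t\<close>, so it is zero, and
  translating it by \<open>x\<close> yields a gap.\<close>

lemma gap_exists:
  assumes "\<zero> \<prec> a" "x \<prec> y"
  obtains b where "\<zero> \<prec> b" "x \<oplus> b \<preceq> y"
proof (rule ccontr)
  assume no: "\<not> thesis"
  note xy = lt_carrier[OF assms(2)]
  define X where "X = {b. \<zero> \<prec> b}"
  have XR: "X \<subseteq> carrier R" by (auto simp: X_def lt_def)
  obtain t where t: "t \<in> carrier R" "\<And>x. x \<in> X \<Longrightarrow> t \<preceq> x"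
    and tr: "\<And>r v. \<lbrakk>r \<in> carrier R; v \<in> carrier R; \<And>x. x \<in> X \<Longrightarrow> v \<preceq> x \<oplus> r\<rbrakk> \<Longrightarrow> v \<preceq> t \<oplus> r"
    by (rule inf_exists[of X \<zero>]) (use XR assms lt_imp_le in \<open>auto simp: X_def\<close>)
  have "t \<oplus> t \<preceq> t \<oplus> \<zero>"
  proof (rule tr)
    fix b assume "b \<in> X"
    then obtain c where "\<zero> \<prec> c" "c \<oplus> c = b"
      unfolding X_def mem_Collect_eq by (rule positive_half_exists)
    then show "t \<oplus> t \<preceq> b \<oplus> \<zero>"
      using add_mono2[of t c t c] t XR by (auto simp: X_def)
  qed (use t in auto)
  then have t0: "t \<preceq> \<zero>" using add_le_cancel_left[of t \<zero> t] t by simp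
  have "y \<preceq> t \<oplus> x"
  proof (rule tr)
    fix b assume "b \<in> X"
    then have b: "\<zero> \<prec> b" "b \<in> carrier R" by (auto simp: X_def lt_def)
    then have "\<not> x \<oplus> b \<preceq> y" using no that by blast
    then have "y \<prec> x \<oplus> b" using not_le xy b by simp
    then show "y \<preceq> b \<oplus> x" using lt_imp_le a_comm xy b by simp
  qed (use xy in auto)
  also have "t \<oplus> x \<preceq> \<zero> \<oplus> x" using t0 add_mono t xy by blast
  finally (le_trans) show False using assms(2) xy by (simp add: lt_def)
qed

text \<open>The difference is the supremum of the \<open>w\<close> with
  \<open>x \<oplus> w \<preceq> y\<close>. The Archimedean property bounds these \<open>w\<close>,
  commuting with translation by \<open>x\<close> keeps the supremum among them, and any remaining
  gap could be added to it. Some positive \<open>a\<close> is assumed because the sign of one is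
  still unknown.\<close>

lemma difference_exists:
  assumes "\<zero> \<prec> a" "x \<preceq> y" "x \<in> carrier R" "y \<in> carrier R"
  obtains z where "z \<in> carrier R" "\<zero> \<preceq> z" "x \<oplus> z = y"
proof -
  note a = lt_carrier(2)[OF assms(1)]
  define W where "W = {w \<in> carrier R. x \<oplus> w \<preceq> y}"
  have WR: "W \<subseteq> carrier R" by (auto simp: W_def)
  have zW: "\<zero> \<in> W" using assms by (simp add: W_def)
  obtain m :: nat where m: "y \<prec> x \<oplus> [m] \<cdot> a"
    by (rule archimedean[OF assms(1,3,4)])
  obtain s where s: "s \<in> carrier R" "\<And>w. w \<in> W \<Longrightarrow> w \<preceq> s"
    and t: "\<And>r v. \<lbrakk>r \<in> carrier R; v \<in> carrier R; \<And>w. w \<in> W \<Longrightarrow> w \<oplus> r \<preceq> v\<rbrakk> \<Longrightarrow> s \<oplus> r \<preceq> v"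
  proof (rule sup_exists[of W "[m] \<cdot> a"])
    fix w assume w: "w \<in> W"
    then have "x \<oplus> w \<preceq> x \<oplus> [m] \<cdot> a" using m le_trans lt_imp_le unfolding W_def by blast
    then show "w \<preceq> [m] \<cdot> a" using add_le_cancel_left assms a WR w by blast
  qed (use WR zW a in auto)
  have "s \<oplus> x \<preceq> y"
    by (rule t) (use assms in \<open>auto simp: W_def a_comm\<close>)
  then have le: "x \<oplus> s \<preceq> y" using s assms by (simp add: a_comm)
  have "x \<oplus> s = y"
  proof (rule ccontr)
    assume "x \<oplus> s \<noteq> y"
    then have "x \<oplus> s \<prec> y" using le lt_iff s assms by simp
    then obtain b where b: "\<zero> \<prec> b" "x \<oplus> s \<oplus> b \<preceq> y" by (rule gap_exists[OF assms(1)])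
    then have "s \<oplus> b \<preceq> s"
      using s lt_carrier[OF b(1)] assms by (auto simp: W_def a_assoc)
    then have "b \<preceq> \<zero>" using add_le_cancel_left[of b \<zero> s] s lt_carrier[OF b(1)] by simp
    then show False using b by (simp add: lt_def)
  qed
  then show ?thesis using that s zW by blast
qed

text \<open>A positive element together with \<open>\<one> \<preceq> \<zero>\<close> would give a
  nonnegative \<open>z\<close> playing the part of minus one, and its square, one, would be
  nonnegative. The second alternative does occur, for the nonnegative reals with reversed
  order.\<close>

lemma one_positive_or_nonpositive: "\<zero> \<prec> \<one> \<or> (\<forall>x\<in>carrier R. x \<preceq> \<zero>)"
proof (rule ccontr)
  assume "\<not> ?thesis"
  then obtain a where "\<zero> \<prec> a" and "\<one> \<preceq> \<zero>" using not_le by auto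
  then obtain z where z: "z \<in> carrier R" "\<zero> \<preceq> z" "\<one> \<oplus> z = \<zero>"
    by (rule difference_exists) auto
  have "z \<otimes> z \<oplus> z = (\<one> \<oplus> z) \<otimes> z"
    using z(1) by (simp add: l_distr a_comm)
  then have "z \<otimes> z \<oplus> z = \<one> \<oplus> z" using z by simp
  then have "z \<otimes> z = \<one>" using add_cancel z by blast
  then have "\<zero> \<preceq> \<one>" using mult_nonneg z by metis
  then show False using \<open>\<one> \<preceq> \<zero>\<close> le_antisym zero_neq_one by blast
qed

end

text \<open>Rounding \<open>n\<close> times a quantity costs an error independent of
  \<open>n\<close>. Such bounded errors become equalities here, which is how additivity and
  multiplicativity are obtained.\<close>

lemma real_eq_if_multiples_close:
  fixes u v c :: real
  assumes "\<And>n::nat. n > 0 \<Longrightarrow> real n * \<bar>u - v\<bar> \<le> c"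
  shows "u = v"
proof (rule ccontr)
  assume "u \<noteq> v"
  then obtain n :: nat where n: "c < real n * \<bar>u - v\<bar>"
    using reals_Archimedean3[of "\<bar>u - v\<bar>"] by auto
  have "real n * \<bar>u - v\<bar> \<le> real (Suc n) * \<bar>u - v\<bar>" by (rule mult_right_mono) auto
  with n assms[of "Suc n"] show False by simp
qed

section \<open>Rational cuts over the natural multiples of one\<close>

locale positive_complete_semifield = complete_ordered_semifield +
  assumes one_positive: "\<zero> \<prec> \<one>"
begin

definition emb :: "nat \<Rightarrow> 'a" where
  "emb n = [n] \<cdot> \<one>"

lemma emb_closed [simp]: "emb n \<in> carrier R"
  by (simp add: emb_def)

lemma emb_0 [simp]: "emb 0 = \<zero>"
  by (simp add: emb_def)

lemma emb_Suc: "emb (Suc n) = emb n \<oplus> \<one>"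
  by (simp add: emb_def)

lemma emb_1 [simp]: "emb (Suc 0) = \<one>"
  by (simp add: emb_Suc)

lemma emb_add: "emb (m + n) = emb m \<oplus> emb n"
  by (induction n) (auto simp: emb_Suc a_assoc)

lemma add_pow_eq_emb_mult: "x \<in> carrier R \<Longrightarrow> [n] \<cdot> x = emb n \<otimes> x" for n :: nat
  using add_pow_ldistr[of \<one> x n] by (simp add: emb_def)

lemma emb_mult: "emb (m * n) = emb m \<otimes> emb n"
  by (induction m) (auto simp: emb_Suc emb_add l_distr a_comm)

lemma nonneg_difference:
  assumes "x \<preceq> y" "x \<in> carrier R" "y \<in> carrier R"
  obtains z where "z \<in> carrier R" "\<zero> \<preceq> z" "y = x \<oplus> z"
  using difference_exists[OF one_positive assms] by metis

text \<open>The axioms only make products of nonnegative elements nonnegative; monotonicity comes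
  from expanding \<open>c \<otimes> (x \<oplus> z)\<close>.\<close>

lemma mult_left_mono:
  assumes "x \<preceq> y" "\<zero> \<preceq> c" "x \<in> carrier R" "y \<in> carrier R" "c \<in> carrier R"
  shows "c \<otimes> x \<preceq> c \<otimes> y"
proof -
  obtain z where z: "z \<in> carrier R" "\<zero> \<preceq> z" "y = x \<oplus> z"
    by (rule nonneg_difference[OF assms(1,3,4)])
  then show ?thesis
    using assms mult_nonneg[of c z] by (simp add: r_distr le_add_left)
qed

lemma emb_nonneg: "\<zero> \<preceq> emb n"
proof (induction n)
  case (Suc n)
  show ?case
    using add_mono2[OF Suc lt_imp_le[OF one_positive]] by (simp add: emb_Suc)
qed (simp add: le_refl)

lemma emb_le_iff: "emb m \<preceq> emb n \<longleftrightarrow> m \<le> n"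
proof
  assume "m \<le> n"
  then have "emb n = emb m \<oplus> emb (n - m)" by (simp flip: emb_add)
  then show "emb m \<preceq> emb n" using le_add_left emb_nonneg by simp
next
  assume le: "emb m \<preceq> emb n"
  show "m \<le> n"
  proof (rule ccontr)
    assume "\<not> m \<le> n"
    then obtain k where "m = n + Suc k" using less_imp_Suc_add[of n m] by auto
    then have "emb n \<oplus> emb (Suc k) \<preceq> emb n \<oplus> \<zero>" using le by (simp flip: emb_add)
    then have "emb (Suc k) \<preceq> \<zero>" using add_le_cancel_left emb_closed zero_closed by blast
    moreover have "\<one> \<preceq> emb (Suc k)"
      using le_add_left[of \<one> "emb k"] emb_nonneg by (simp add: emb_Suc a_comm)
    ultimately show False using one_positive le_trans unfolding lt_def by blast
  qed
qed

text \<open>Both bounds are compared with \<open>n n'\<close> times \<open>x\<close>. This is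
  transitivity of \<open>m'/n' \<le> x \<le> m/n\<close> cleared of denominators, so zero
  denominators are harmless.\<close>

lemma cut_le:
  assumes "emb m' \<preceq> emb n' \<otimes> x" "emb n \<otimes> x \<preceq> emb m" "x \<in> carrier R"
  shows "m' * n \<le> m * n'"
proof -
  have "emb n \<otimes> emb m' \<preceq> emb n \<otimes> (emb n' \<otimes> x)"
    by (rule mult_left_mono) (use assms emb_nonneg in auto)
  also have "emb n \<otimes> (emb n' \<otimes> x) = emb n' \<otimes> (emb n \<otimes> x)"
    using assms by (simp add: m_lcomm)
  also have "emb n' \<otimes> (emb n \<otimes> x) \<preceq> emb n' \<otimes> emb m"
    by (rule mult_left_mono) (use assms emb_nonneg in auto)
  finally (le_trans) show ?thesis by (simp add: emb_le_iff mult.commute flip: emb_mult)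
qed

text \<open>\<open>m\<close> is the predecessor of the ceiling of \<open>n x\<close>, or zero if
  that ceiling is zero; this is why both bounds are weak.\<close>

lemma floor_exists:
  assumes "x \<in> carrier R" "\<zero> \<preceq> x"
  obtains m where "emb m \<preceq> emb n \<otimes> x" "emb n \<otimes> x \<preceq> emb (Suc m)"
proof -
  define y where "y = emb n \<otimes> x"
  have y: "y \<in> carrier R" "\<zero> \<preceq> y" using assms mult_nonneg emb_nonneg by (auto simp: y_def)
  obtain k :: nat where k: "y \<prec> \<zero> \<oplus> [k] \<cdot> \<one>"
    by (rule archimedean[OF one_positive zero_closed y(1)])
  then have "y \<preceq> emb k" using lt_imp_le by (simp add: emb_def)
  then have le: "y \<preceq> emb (LEAST k. y \<preceq> emb k)" by (rule LeastI)
  show ?thesis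
  proof (cases "LEAST k. y \<preceq> emb k")
    case 0
    then have "y = \<zero>" using le y le_antisym by simp
    then show ?thesis using that[of 0] y_def le_refl lt_imp_le[OF one_positive] by simp
  next
    case (Suc m)
    then have "\<not> y \<preceq> emb m" using not_less_Least[of m "\<lambda>k. y \<preceq> emb k"] by simp
    then have "emb m \<preceq> y" using le_total[of "emb m" y] y by simp
    then show ?thesis using that[of m] le Suc y_def by simp
  qed
qed

definition nonneg_to_real :: "'a \<Rightarrow> real" where
  "nonneg_to_real x = Sup {real m / real n | m n. n > 0 \<and> emb m \<preceq> emb n \<otimes> x}"

lemma nonneg_to_real_ge:
  assumes "x \<in> carrier R" "\<zero> \<preceq> x" "emb m \<preceq> emb n \<otimes> x"
  shows "real m \<le> real n * nonneg_to_real x"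
proof (cases "n = 0")
  case True
  then show ?thesis using assms emb_le_iff[of m 0] by simp
next
  case False
  \<comment> \<open>An integer bound on \<open>x\<close>, at denominator one, bounds the whole
    cut.\<close>
  obtain k where k: "emb 1 \<otimes> x \<preceq> emb (Suc k)" using assms(1,2) by (rule floor_exists)
  have "real m' / real n' \<le> real (Suc k)" if "n' > 0" "emb m' \<preceq> emb n' \<otimes> x" for m' n'
  proof -
    have "m' \<le> Suc k * n'" using cut_le[OF that(2) k assms(1)] by simp
    then have "real m' \<le> real (Suc k) * real n'" by (metis of_nat_le_iff of_nat_mult)
    then show ?thesis using that by (simp add: divide_le_eq)
  qed
  then have "bdd_above {real m / real n | m n. n > 0 \<and> emb m \<preceq> emb n \<otimes> x}"
    by (intro bdd_aboveI[of _ "real (Suc k)"]) blast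
  then have "real m / real n \<le> nonneg_to_real x"
    unfolding nonneg_to_real_def by (rule cSup_upper[rotated]) (use False assms in blast)
  then show ?thesis using False by (simp add: divide_le_eq mult.commute)
qed

lemma nonneg_to_real_le:
  assumes "x \<in> carrier R" "\<zero> \<preceq> x" "emb n \<otimes> x \<preceq> emb m" "n > 0"
  shows "real n * nonneg_to_real x \<le> real m"
proof -
  have "nonneg_to_real x \<le> real m / real n"
    unfolding nonneg_to_real_def
  proof (rule cSup_least)
    have "emb 0 \<preceq> emb 1 \<otimes> x" using assms by simp
    then show "{real m / real n | m n. n > 0 \<and> emb m \<preceq> emb n \<otimes> x} \<noteq> {}" by blast
    fix q assume "q \<in> {real m / real n | m n. n > 0 \<and> emb m \<preceq> emb n \<otimes> x}"
    then obtain m' n' where q: "q = real m' / real n'" "n' > 0" "emb m' \<preceq> emb n' \<otimes> x" by blast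
    have "real m' * real n \<le> real m * real n'"
      using cut_le[OF q(3) assms(3,1)] by (metis of_nat_le_iff of_nat_mult)
    then show "q \<le> real m / real n" using q(2) assms(4) unfolding q(1) by (simp add: field_simps)
  qed
  then show ?thesis using assms by (simp add: le_divide_eq mult.commute)
qed

lemma nonneg_to_real_emb: "nonneg_to_real (emb m) = real m"
  using nonneg_to_real_ge[of "emb m" m 1] nonneg_to_real_le[of "emb m" 1 m]
  by (simp add: emb_nonneg le_refl)

lemma nonneg_to_real_nonneg: "\<lbrakk>x \<in> carrier R; \<zero> \<preceq> x\<rbrakk> \<Longrightarrow> 0 \<le> nonneg_to_real x"
  using nonneg_to_real_ge[of x 0 1] by simp

lemma add_nonneg: "\<lbrakk>\<zero> \<preceq> x; \<zero> \<preceq> y; x \<in> carrier R; y \<in> carrier R\<rbrakk> \<Longrightarrow> \<zero> \<preceq> x \<oplus> y"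
  using add_mono2[of \<zero> x \<zero> y] by simp

lemma nonneg_to_real_add:
  assumes x: "x \<in> carrier R" "\<zero> \<preceq> x" and y: "y \<in> carrier R" "\<zero> \<preceq> y"
  shows "nonneg_to_real (x \<oplus> y) = nonneg_to_real x + nonneg_to_real y"
\<comment> \<open>After scaling by \<open>n\<close>, both sides lie between \<open>k + l\<close> and
  \<open>k + l + 2\<close>, whence the constant.\<close>
proof (rule real_eq_if_multiples_close[where c = 2])
  fix n :: nat assume n: "n > 0"
  have xy: "x \<oplus> y \<in> carrier R" "\<zero> \<preceq> x \<oplus> y" using x y add_nonneg by auto
  obtain k where k: "emb k \<preceq> emb n \<otimes> x" "emb n \<otimes> x \<preceq> emb (Suc k)"
    using x by (rule floor_exists)
  obtain l where l: "emb l \<preceq> emb n \<otimes> y" "emb n \<otimes> y \<preceq> emb (Suc l)"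
    using y by (rule floor_exists)
  have "emb (k + l) \<preceq> emb n \<otimes> (x \<oplus> y)"
    using add_mono2[OF k(1) l(1)] x y by (simp add: emb_add r_distr)
  then have "real (k + l) \<le> real n * nonneg_to_real (x \<oplus> y)"
    using nonneg_to_real_ge xy by blast
  moreover have "emb n \<otimes> (x \<oplus> y) \<preceq> emb (Suc k + Suc l)"
    using add_mono2[OF k(2) l(2)] x y by (simp only: emb_add r_distr emb_closed m_closed)
  then have "real n * nonneg_to_real (x \<oplus> y) \<le> real (Suc k + Suc l)"
    using nonneg_to_real_le xy n by blast
  moreover have "real k \<le> real n * nonneg_to_real x" "real n * nonneg_to_real x \<le> real (Suc k)"
    "real l \<le> real n * nonneg_to_real y" "real n * nonneg_to_real y \<le> real (Suc l)"
    using nonneg_to_real_ge nonneg_to_real_le x y k l n by blast+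
  ultimately have "\<bar>real n * nonneg_to_real (x \<oplus> y)
      - (real n * nonneg_to_real x + real n * nonneg_to_real y)\<bar> \<le> 2"
    by simp
  also have "real n * nonneg_to_real (x \<oplus> y)
      - (real n * nonneg_to_real x + real n * nonneg_to_real y)
      = real n * (nonneg_to_real (x \<oplus> y) - (nonneg_to_real x + nonneg_to_real y))"
    by (simp add: algebra_simps)
  finally show "real n * \<bar>nonneg_to_real (x \<oplus> y) - (nonneg_to_real x + nonneg_to_real y)\<bar> \<le> 2"
    by (simp add: abs_mult)
qed

lemma nonneg_to_real_mono:
  assumes "x \<preceq> y" "\<zero> \<preceq> x" "x \<in> carrier R" "y \<in> carrier R"
  shows "nonneg_to_real x \<le> nonneg_to_real y"
proof -
  obtain z where "z \<in> carrier R" "\<zero> \<preceq> z" "y = x \<oplus> z"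
    by (rule nonneg_difference[OF assms(1,3,4)])
  then show ?thesis using assms by (simp add: nonneg_to_real_add nonneg_to_real_nonneg)
qed

lemma nonneg_to_real_emb_mult:
  assumes "x \<in> carrier R" "\<zero> \<preceq> x"
  shows "nonneg_to_real (emb n \<otimes> x) = real n * nonneg_to_real x"
proof (induction n)
  case 0
  then show ?case using nonneg_to_real_emb[of 0] assms by simp
next
  case (Suc n)
  then show ?case
    using assms by (simp add: emb_Suc l_distr nonneg_to_real_add mult_nonneg emb_nonneg algebra_simps)
qed

text \<open>Both sides lie between \<open>m / n\<close> and \<open>(m + 1) / n\<close> times the image of \<open>c\<close>.\<close>

lemma nonneg_to_real_mult:
  assumes c: "c \<in> carrier R" "\<zero> \<preceq> c" and x: "x \<in> carrier R" "\<zero> \<preceq> x"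
  shows "nonneg_to_real (c \<otimes> x) = nonneg_to_real c * nonneg_to_real x"
proof (rule real_eq_if_multiples_close[where c = "nonneg_to_real c"])
  fix n :: nat assume n: "n > 0"
  obtain m where m: "emb m \<preceq> emb n \<otimes> x" "emb n \<otimes> x \<preceq> emb (Suc m)"
    using x by (rule floor_exists)
  have cx: "c \<otimes> x \<in> carrier R" "\<zero> \<preceq> c \<otimes> x" using c x mult_nonneg by auto
  have swap: "c \<otimes> (emb n \<otimes> x) = emb n \<otimes> (c \<otimes> x)" using c x by (simp add: m_lcomm)
  have em: "emb m \<otimes> c \<preceq> emb n \<otimes> (c \<otimes> x)" "emb n \<otimes> (c \<otimes> x) \<preceq> emb (Suc m) \<otimes> c"
    using mult_left_mono[OF m(1) c(2)] mult_left_mono[OF m(2) c(2)] c x swap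
    by (simp_all add: m_comm)
  have lower: "real m * nonneg_to_real c \<le> real n * nonneg_to_real (c \<otimes> x)"
    using nonneg_to_real_mono[OF em(1)] c cx
    by (simp add: nonneg_to_real_emb_mult mult_nonneg emb_nonneg)
  have upper: "real n * nonneg_to_real (c \<otimes> x) \<le> real (Suc m) * nonneg_to_real c"
    using nonneg_to_real_mono[OF em(2)] c cx
    by (simp add: nonneg_to_real_emb_mult mult_nonneg emb_nonneg)
  have "real m \<le> real n * nonneg_to_real x" "real n * nonneg_to_real x \<le> real (Suc m)"
    using nonneg_to_real_ge nonneg_to_real_le x m n by blast+
  then have "real m * nonneg_to_real c \<le> real n * nonneg_to_real x * nonneg_to_real c"
    "real n * nonneg_to_real x * nonneg_to_real c \<le> real (Suc m) * nonneg_to_real c"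
    using nonneg_to_real_nonneg[OF c] by (meson mult_right_mono)+
  then have "\<bar>real n * nonneg_to_real (c \<otimes> x) - real n * nonneg_to_real x * nonneg_to_real c\<bar>
      \<le> nonneg_to_real c"
    using lower upper by (simp add: algebra_simps abs_le_iff)
  also have "real n * nonneg_to_real (c \<otimes> x) - real n * nonneg_to_real x * nonneg_to_real c
      = real n * (nonneg_to_real (c \<otimes> x) - nonneg_to_real c * nonneg_to_real x)"
    by (simp add: algebra_simps)
  finally show "real n * \<bar>nonneg_to_real (c \<otimes> x) - nonneg_to_real c * nonneg_to_real x\<bar>
      \<le> nonneg_to_real c"
    by (simp add: abs_mult)
qed

text \<open>Cuts would send positive infinitesimals to zero; the Archimedean property excludes them
  by bringing a multiple of \<open>x\<close> above one.\<close>

lemma nonneg_to_real_pos: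
  assumes "\<zero> \<prec> x"
  shows "0 < nonneg_to_real x"
proof -
  have x: "x \<in> carrier R" "\<zero> \<preceq> x" using assms lt_carrier lt_imp_le by auto
  obtain k :: nat where k: "\<one> \<prec> \<zero> \<oplus> [k] \<cdot> x"
    by (rule archimedean[OF assms zero_closed one_closed])
  then have "\<one> \<preceq> emb k \<otimes> x" using x lt_imp_le by (simp add: add_pow_eq_emb_mult)
  then have "1 \<le> real k * nonneg_to_real x"
    using nonneg_to_real_ge[of x 1 k] x by simp
  then show ?thesis using nonneg_to_real_nonneg[OF x] by (cases "nonneg_to_real x = 0") auto
qed

lemma nonneg_to_real_le_iff:
  assumes "x \<in> carrier R" "\<zero> \<preceq> x" "y \<in> carrier R" "\<zero> \<preceq> y"
  shows "nonneg_to_real x \<le> nonneg_to_real y \<longleftrightarrow> x \<preceq> y"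
proof
  assume le: "nonneg_to_real x \<le> nonneg_to_real y"
  show "x \<preceq> y"
  proof (rule ccontr)
    assume "\<not> x \<preceq> y"
    then have "y \<preceq> x" using le_total assms by blast
    then obtain z where z: "z \<in> carrier R" "\<zero> \<preceq> z" "x = y \<oplus> z"
      by (rule nonneg_difference[OF _ assms(3,1)])
    then have "z \<noteq> \<zero>" using \<open>\<not> x \<preceq> y\<close> assms le_refl by auto
    then have "0 < nonneg_to_real z" using nonneg_to_real_pos lt_iff z by auto
    then show False using le z assms by (simp add: nonneg_to_real_add)
  qed
qed (use nonneg_to_real_mono assms in blast)

lemma nonneg_to_real_inj:
  assumes "nonneg_to_real x = nonneg_to_real y"
    and "x \<in> carrier R" "\<zero> \<preceq> x" "y \<in> carrier R" "\<zero> \<preceq> y"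
  shows "x = y"
  using nonneg_to_real_le_iff[of x y] nonneg_to_real_le_iff[of y x] assms le_antisym by simp

lemma unit_fraction_exists:
  assumes "n > 0"
  obtains b where "b \<in> carrier R" "\<zero> \<preceq> b" "nonneg_to_real b = 1 / real n"
proof -
  have "emb n \<noteq> \<zero>" using emb_le_iff[of n 0] assms le_refl by auto
  then obtain b where b: "b \<in> carrier R" "emb n \<otimes> b = \<one>" using inverse_exists emb_closed by blast
  have "\<zero> \<preceq> b"
  proof (rule ccontr)
    assume "\<not> \<zero> \<preceq> b"
    then have "b \<preceq> \<zero>" using le_total b by blast
    then have "emb n \<otimes> b \<preceq> emb n \<otimes> \<zero>"
      using mult_left_mono[of b \<zero> "emb n"] emb_nonneg b by simp
    then show False using b one_positive by (simp add: lt_def)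
  qed
  then have "real n * nonneg_to_real b = 1"
    using nonneg_to_real_emb_mult[of b n] b nonneg_to_real_emb[of 1] by simp
  then show ?thesis using that b \<open>\<zero> \<preceq> b\<close> assms by (simp add: field_simps)
qed

text \<open>Take the supremum \<open>s\<close> of the elements with image at most \<open>r\<close>.
  If its image fell short of \<open>r\<close>, a unit fraction could be added without leaving
  \<open>X\<close>; if it exceeded \<open>r\<close>, removing a unit fraction would leave a smaller
  upper bound.\<close>

lemma nonneg_to_real_surj:
  assumes "0 \<le> r"
  obtains x where "x \<in> carrier R" "\<zero> \<preceq> x" "nonneg_to_real x = r"
proof -
  define X where "X = {x \<in> carrier R. \<zero> \<preceq> x \<and> nonneg_to_real x \<le> r}"
  have zX: "\<zero> \<in> X" using nonneg_to_real_emb[of 0] assms le_refl by (simp add: X_def)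
  obtain M :: nat where M: "r \<le> real M" using real_arch_simple by blast
  obtain s where s: "s \<in> carrier R" "\<And>x. x \<in> X \<Longrightarrow> x \<preceq> s"
    and t: "\<And>r v. \<lbrakk>r \<in> carrier R; v \<in> carrier R; \<And>x. x \<in> X \<Longrightarrow> x \<oplus> r \<preceq> v\<rbrakk> \<Longrightarrow> s \<oplus> r \<preceq> v"
  proof (rule sup_exists[of X "emb M"])
    fix x assume "x \<in> X"
    then have x: "x \<in> carrier R" "\<zero> \<preceq> x" "nonneg_to_real x \<le> r" by (auto simp: X_def)
    then have "nonneg_to_real x \<le> nonneg_to_real (emb M)" using M nonneg_to_real_emb by simp
    then show "x \<preceq> emb M" using nonneg_to_real_le_iff x emb_nonneg by simp
  qed (use zX in \<open>auto simp: X_def\<close>)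
  have s0: "\<zero> \<preceq> s" using s zX by blast
  have "\<not> nonneg_to_real s < r"
  proof
    assume "nonneg_to_real s < r"
    then obtain n :: nat where n: "n > 0" "1 / real n < r - nonneg_to_real s"
      using nat_approx_posE[of "r - nonneg_to_real s"] by (metis diff_gt_0_iff_gt zero_less_Suc)
    obtain b where b: "b \<in> carrier R" "\<zero> \<preceq> b" "nonneg_to_real b = 1 / real n"
      by (rule unit_fraction_exists[OF n(1)])
    have "s \<oplus> b \<in> X" using s s0 b n by (simp add: X_def add_nonneg nonneg_to_real_add)
    then have "nonneg_to_real (s \<oplus> b) \<le> nonneg_to_real s"
      using nonneg_to_real_mono s s0 b add_nonneg by simp
    then show False using s s0 b n by (simp add: nonneg_to_real_add)
  qed
  moreover have "\<not> r < nonneg_to_real s"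
  proof
    assume "r < nonneg_to_real s"
    then obtain n :: nat where n: "n > 0" "1 / real n < nonneg_to_real s - r"
      using nat_approx_posE[of "nonneg_to_real s - r"] by (metis diff_gt_0_iff_gt zero_less_Suc)
    obtain b where b: "b \<in> carrier R" "\<zero> \<preceq> b" "nonneg_to_real b = 1 / real n"
      by (rule unit_fraction_exists[OF n(1)])
    \<comment> \<open>Since \<open>r\<close> is nonnegative, \<open>1 / n\<close> is less than the
      image of \<open>s\<close>; this makes \<open>b\<close> subtractable from
      \<open>s\<close>.\<close>
    have "nonneg_to_real b \<le> nonneg_to_real s" using n b assms by simp
    then have "b \<preceq> s" using nonneg_to_real_le_iff[of b s] b s(1) s0 by simp
    then obtain z where z: "z \<in> carrier R" "\<zero> \<preceq> z" "s = b \<oplus> z"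
      by (rule nonneg_difference[OF _ b(1) s(1)])
    then have fs: "nonneg_to_real s = 1 / real n + nonneg_to_real z"
      using b by (simp add: nonneg_to_real_add)
    have "s \<oplus> \<zero> \<preceq> z"
    proof (rule t)
      fix x assume "x \<in> X"
      then have x: "x \<in> carrier R" "\<zero> \<preceq> x" "nonneg_to_real x \<le> r" by (auto simp: X_def)
      then have "nonneg_to_real x \<le> nonneg_to_real z" using fs n by simp
      then show "x \<oplus> \<zero> \<preceq> z" using nonneg_to_real_le_iff x z by simp
    qed (use z in auto)
    then have "nonneg_to_real s \<le> nonneg_to_real z" using nonneg_to_real_mono s s0 z by simp
    then show False using fs n by simp
  qed
  ultimately show ?thesis using that s s0 by simp
qed

text \<open>A negative element is first shifted into the nonnegative range by a natural number.\<close>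

definition to_real :: "'a \<Rightarrow> real" where
  "to_real x = (let N = SOME N. \<zero> \<preceq> x \<oplus> emb N in nonneg_to_real (x \<oplus> emb N) - real N)"

lemma shift_exists:
  assumes "x \<in> carrier R"
  obtains N where "\<zero> \<preceq> x \<oplus> emb N"
proof -
  obtain N :: nat where "\<zero> \<prec> x \<oplus> [N] \<cdot> \<one>"
    by (rule archimedean[OF one_positive assms zero_closed])
  then have "\<zero> \<preceq> x \<oplus> emb N" unfolding emb_def by (rule lt_imp_le)
  then show ?thesis by (rule that)
qed

text \<open>Two admissible shifts are compared by adding to each shifted element the shift of the
  other, so the choice made in \<open>to_real\<close> does not matter.\<close>

lemma to_real_eq:
  assumes "x \<in> carrier R" "\<zero> \<preceq> x \<oplus> emb N"
  shows "to_real x = nonneg_to_real (x \<oplus> emb N) - real N"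
proof -
  define M where "M = (SOME N. \<zero> \<preceq> x \<oplus> emb N)"
  have M: "\<zero> \<preceq> x \<oplus> emb M" unfolding M_def using assms(2) by (rule someI)
  have "x \<oplus> emb M \<oplus> emb N = x \<oplus> emb N \<oplus> emb M" using assms by (simp add: a_ac)
  then have "nonneg_to_real (x \<oplus> emb M) + real N = nonneg_to_real (x \<oplus> emb N) + real M"
    using assms M nonneg_to_real_add[of "x \<oplus> emb M" "emb N"] nonneg_to_real_add[of "x \<oplus> emb N" "emb M"]
    by (simp add: emb_nonneg nonneg_to_real_emb)
  then show ?thesis by (simp add: to_real_def Let_def flip: M_def)
qed

lemma to_real_nonneg_eq: "\<lbrakk>x \<in> carrier R; \<zero> \<preceq> x\<rbrakk> \<Longrightarrow> to_real x = nonneg_to_real x"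
  using to_real_eq[of x 0] by simp

lemma to_real_add:
  assumes "x \<in> carrier R" "y \<in> carrier R"
  shows "to_real (x \<oplus> y) = to_real x + to_real y"
proof -
  obtain N where N: "\<zero> \<preceq> x \<oplus> emb N" using assms(1) by (rule shift_exists)
  obtain M where M: "\<zero> \<preceq> y \<oplus> emb M" using assms(2) by (rule shift_exists)
  have eq: "x \<oplus> y \<oplus> emb (N + M) = (x \<oplus> emb N) \<oplus> (y \<oplus> emb M)"
    using assms by (simp add: emb_add a_ac)
  then have "\<zero> \<preceq> x \<oplus> y \<oplus> emb (N + M)" using add_nonneg[OF N M] assms by simp
  then show ?thesis
    using assms N M eq by (simp add: to_real_eq[of _ "N + M"] to_real_eq[of _ N] to_real_eq[of _ M]
        nonneg_to_real_add)
qed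

lemma to_real_mult:
  assumes "x \<in> carrier R" "y \<in> carrier R"
  shows "to_real (x \<otimes> y) = to_real x * to_real y"
proof -
  obtain N where N: "\<zero> \<preceq> x \<oplus> emb N" using assms(1) by (rule shift_exists)
  obtain M where M: "\<zero> \<preceq> y \<oplus> emb M" using assms(2) by (rule shift_exists)
  have emb: "to_real (emb n) = real n" for n
    by (simp add: to_real_nonneg_eq emb_nonneg nonneg_to_real_emb)
  \<comment> \<open>The cross terms multiply a natural number by the unshifted \<open>x\<close> or
    \<open>y\<close>, which may be negative; for these, additivity and induction suffice.\<close>
  have emb_mult: "to_real (emb n \<otimes> z) = real n * to_real z" if "z \<in> carrier R" for n z
    by (induction n)
       (use that emb[of 0] in \<open>auto simp: emb_Suc l_distr to_real_add algebra_simps\<close>)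
  have "(x \<oplus> emb N) \<otimes> (y \<oplus> emb M) = x \<otimes> y \<oplus> emb M \<otimes> x \<oplus> (emb N \<otimes> y \<oplus> emb N \<otimes> emb M)"
    using assms by (simp add: l_distr r_distr m_comm a_ac)
  then have "to_real ((x \<oplus> emb N) \<otimes> (y \<oplus> emb M))
      = to_real (x \<otimes> y) + real M * to_real x + (real N * to_real y + real N * real M)"
    using assms by (simp add: to_real_add emb_mult emb)
  moreover have "to_real ((x \<oplus> emb N) \<otimes> (y \<oplus> emb M)) = to_real (x \<oplus> emb N) * to_real (y \<oplus> emb M)"
    using assms N M mult_nonneg[OF N M] by (simp add: to_real_nonneg_eq nonneg_to_real_mult)
  moreover have "to_real (x \<oplus> emb N) * to_real (y \<oplus> emb M) = (to_real x + real N) * (to_real y + real M)"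
    using assms by (simp add: to_real_add emb)
  ultimately show ?thesis by (simp add: algebra_simps)
qed

lemma to_real_inj: "inj_on to_real (carrier R)"
proof (rule inj_onI)
  fix x y assume xy: "x \<in> carrier R" "y \<in> carrier R" "to_real x = to_real y"
  obtain N where N: "\<zero> \<preceq> x \<oplus> emb N" using xy(1) by (rule shift_exists)
  obtain M where M: "\<zero> \<preceq> y \<oplus> emb M" using xy(2) by (rule shift_exists)
  have sx: "\<zero> \<preceq> x \<oplus> emb (N + M)"
    using add_nonneg[OF N emb_nonneg[of M]] xy by (simp add: emb_add a_assoc)
  have sy: "\<zero> \<preceq> y \<oplus> emb (N + M)"
    using add_nonneg[OF M emb_nonneg[of N]] xy by (simp add: emb_add a_ac)
  have "nonneg_to_real (x \<oplus> emb (N + M)) = nonneg_to_real (y \<oplus> emb (N + M))"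
    using xy to_real_eq[OF _ sx] to_real_eq[OF _ sy] by simp
  then have "x \<oplus> emb (N + M) = y \<oplus> emb (N + M)" using nonneg_to_real_inj sx sy xy by simp
  then show "x = y" using add_cancel xy emb_closed by blast
qed

text \<open>The nonnegative reals are themselves an instance, so negative reals cannot be expected
  in the image. The nonnegative ones are recorded because square roots are taken later.\<close>

lemma real_embedding:
  "\<exists>\<psi> :: 'a \<Rightarrow> real. inj_on \<psi> (carrier R) \<and> \<psi> \<zero> = 0 \<and> \<psi> \<one> = 1 \<and>
    (\<forall>x\<in>carrier R. \<forall>y\<in>carrier R. \<psi> (x \<oplus> y) = \<psi> x + \<psi> y \<and> \<psi> (x \<otimes> y) = \<psi> x * \<psi> y) \<and>
    (\<forall>r\<ge>0. \<exists>x\<in>carrier R. \<psi> x = r)"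
proof (intro exI[of _ to_real] conjI)
  show "\<forall>r\<ge>0. \<exists>x\<in>carrier R. to_real x = r"
    using nonneg_to_real_surj to_real_nonneg_eq by metis
  show "to_real \<zero> = 0"
    using to_real_nonneg_eq[of \<zero>] nonneg_to_real_emb[of 0] le_refl by simp
  show "to_real \<one> = 1"
    using to_real_nonneg_eq[of \<one>] nonneg_to_real_emb[of 1] emb_nonneg[of 1] by simp
qed (use to_real_inj to_real_add to_real_mult in auto)

end

text \<open>If one is not positive, then every element is nonpositive, and the converse order
  is again compatible with the operations.\<close>

lemma (in complete_ordered_semifield) real_embedding_exists:
  "\<exists>\<psi> :: 'a \<Rightarrow> real. inj_on \<psi> (carrier R) \<and> \<psi> \<zero> = 0 \<and> \<psi> \<one> = 1 \<and>
    (\<forall>x\<in>carrier R. \<forall>y\<in>carrier R. \<psi> (x \<oplus> y) = \<psi> x + \<psi> y \<and> \<psi> (x \<otimes> y) = \<psi> x * \<psi> y) \<and>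
    (\<forall>r\<ge>0. \<exists>x\<in>carrier R. \<psi> x = r)"
proof (cases "\<zero> \<prec> \<one>")
  case True
  then interpret positive_complete_semifield R leq by unfold_locales
  show ?thesis by (rule real_embedding)
next
  case False
  then have nonpos: "x \<preceq> \<zero>" if "x \<in> carrier R" for x
    using one_positive_or_nonpositive that by blast
  interpret conv: complete_ordered_semifield R "leq\<inverse>"
  proof
    have "linear_order_on (carrier R) (leq\<inverse>)"
      using order by (simp add: semiring_order_def)
    then show "semiring_order R (leq\<inverse>)"
      using order nonpos by (auto simp: semiring_order_def le_def)
  qed (use complete complete_dual in simp_all)
  have "conv.lt \<zero> \<one>"
    using nonpos[of \<one>] zero_neq_one le_antisym[of \<zero> \<one>]
    unfolding conv.lt_def conv.le_def le_def by auto
  then interpret conv: positive_complete_semifield R "leq\<inverse>" by unfold_locales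
  show ?thesis by (rule conv.real_embedding)
qed

section \<open>Involutive semifields\<close>

locale involutive_semifield = cancel_semifield R for R (structure) +
  fixes star :: "'a \<Rightarrow> 'a"
  assumes star_closed [simp]: "a \<in> carrier R \<Longrightarrow> star a \<in> carrier R"
    and star_star [simp]: "a \<in> carrier R \<Longrightarrow> star (star a) = a"
    and star_add [simp]: "\<lbrakk>a \<in> carrier R; b \<in> carrier R\<rbrakk> \<Longrightarrow> star (a \<oplus> b) = star a \<oplus> star b"
    and star_mult [simp]: "\<lbrakk>a \<in> carrier R; b \<in> carrier R\<rbrakk> \<Longrightarrow> star (a \<otimes> b) = star a \<otimes> star b"
    and star_zero [simp]: "star \<zero> = \<zero>"
    and star_one [simp]: "star \<one> = \<one>"
    and no_zero_divisor_differences: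
      "\<lbrakk>a \<otimes> c \<oplus> b \<otimes> d = a \<otimes> d \<oplus> b \<otimes> c;
        a \<in> carrier R; b \<in> carrier R; c \<in> carrier R; d \<in> carrier R\<rbrakk> \<Longrightarrow> a = b \<or> c = d"
begin

abbreviation self_adjoint :: "'a set" where
  "self_adjoint \<equiv> {a \<in> carrier R. star a = a}"

lemma self_adjoint_inverse:
  assumes "a \<in> self_adjoint" "a \<noteq> \<zero>"
  obtains b where "b \<in> self_adjoint" "a \<otimes> b = \<one>"
proof -
  obtain b where b: "b \<in> carrier R" "a \<otimes> b = \<one>"
    using inverse_exists assms by blast
  have "a \<otimes> star b = star (a \<otimes> b)" using assms b(1) by simp
  also have "\<dots> = a \<otimes> b" using b by simp
  finally have "star b = b" by (rule mult_left_cancel) (use assms b in auto)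
  then show ?thesis using that b by simp
qed

lemma cancel_semifield_self_adjoint: "cancel_semifield (R\<lparr>carrier := self_adjoint\<rparr>)"
proof -
  have am: "abelian_monoid (R\<lparr>carrier := self_adjoint\<rparr>)"
    by (rule abelian_monoidI) (auto simp: a_ac)
  have cm: "comm_monoid (R\<lparr>carrier := self_adjoint\<rparr>)"
    by (rule comm_monoidI) (auto simp: m_ac)
  show ?thesis
  proof (rule cancel_semifield.intro)
    show "semiring (R\<lparr>carrier := self_adjoint\<rparr>)"
      by (rule semiring.intro[OF am comm_monoid.axioms(1)[OF cm]], rule semiring_axioms.intro)
         (auto simp: l_distr r_distr)
    show "cancel_semifield_axioms (R\<lparr>carrier := self_adjoint\<rparr>)"
    proof
      fix a b c
      assume "a \<oplus>\<^bsub>R\<lparr>carrier := self_adjoint\<rparr>\<^esub> c = b \<oplus>\<^bsub>R\<lparr>carrier := self_adjoint\<rparr>\<^esub> c"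
        "a \<in> carrier (R\<lparr>carrier := self_adjoint\<rparr>)" "b \<in> carrier (R\<lparr>carrier := self_adjoint\<rparr>)"
        "c \<in> carrier (R\<lparr>carrier := self_adjoint\<rparr>)"
      then show "a = b" using add_cancel[of a c b] by simp
    next
      fix a
      assume "a \<in> carrier (R\<lparr>carrier := self_adjoint\<rparr>)" "a \<noteq> \<zero>\<^bsub>R\<lparr>carrier := self_adjoint\<rparr>\<^esub>"
      then have "a \<in> self_adjoint" "a \<noteq> \<zero>" by simp_all
      then obtain b where "b \<in> self_adjoint" "a \<otimes> b = \<one>" by (rule self_adjoint_inverse)
      then show "\<exists>b\<in>carrier (R\<lparr>carrier := self_adjoint\<rparr>).
          a \<otimes>\<^bsub>R\<lparr>carrier := self_adjoint\<rparr>\<^esub> b = \<one>\<^bsub>R\<lparr>carrier := self_adjoint\<rparr>\<^esub>"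
        by auto
    qed (use zero_neq_one in simp)
  qed (rule cm)
qed

end

section \<open>A square root of minus one; real and imaginary parts\<close>

locale involutive_semifield_over_reals = involutive_semifield +
  fixes \<psi> :: "'a \<Rightarrow> real"
  assumes psi_inj: "inj_on \<psi> self_adjoint"
    and psi_zero [simp]: "\<psi> \<zero> = 0"
    and psi_one [simp]: "\<psi> \<one> = 1"
    and psi_add: "\<lbrakk>a \<in> self_adjoint; b \<in> self_adjoint\<rbrakk> \<Longrightarrow> \<psi> (a \<oplus> b) = \<psi> a + \<psi> b"
    and psi_mult: "\<lbrakk>a \<in> self_adjoint; b \<in> self_adjoint\<rbrakk> \<Longrightarrow> \<psi> (a \<otimes> b) = \<psi> a * \<psi> b"
    and psi_surj: "0 \<le> r \<Longrightarrow> \<exists>a\<in>self_adjoint. \<psi> a = r"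
begin

lemma psi_eqD: "\<lbrakk>\<psi> a = \<psi> b; a \<in> self_adjoint; b \<in> self_adjoint\<rbrakk> \<Longrightarrow> a = b"
  using psi_inj by (auto dest: inj_onD)

lemma double_cancel:
  assumes "a \<oplus> a = b \<oplus> b" "a \<in> carrier R" "b \<in> carrier R"
  shows "a = b"
proof (rule mult_left_cancel)
  show "(\<one> \<oplus> \<one>) \<otimes> a = (\<one> \<oplus> \<one>) \<otimes> b" using assms by (simp add: l_distr)
  have "\<psi> (\<one> \<oplus> \<one>) = 2" using psi_add[of \<one> \<one>] by simp
  then show "\<one> \<oplus> \<one> \<noteq> \<zero>" by auto
qed (use assms in auto)

text \<open>In the difference ring, \<open>(s - s\<^sup>*)\<^sup>2\<close> is not a square \<open>w\<^sup>2\<close> of a self-adjoint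
  element, since otherwise \<open>s - s\<^sup>* = \<plusminus> w\<close> would be both self-adjoint and anti-self-adjoint.
  So \<open>-(s - s\<^sup>*)\<^sup>2\<close> is such a square.\<close>

lemma anti_self_adjoint_square:
  assumes s: "s \<in> carrier R" "star s \<noteq> s"
  obtains w where "w \<in> self_adjoint" "w \<noteq> \<zero>"
    "s \<otimes> s \<oplus> star s \<otimes> star s \<oplus> w \<otimes> w = s \<otimes> star s \<oplus> s \<otimes> star s"
proof -
  \<comment> \<open>\<open>p\<close> and \<open>q\<close> collect the positive and the negative
    terms of the square of \<open>s - star s\<close>.\<close>
  define p where "p = s \<otimes> s \<oplus> star s \<otimes> star s"
  define q where "q = s \<otimes> star s \<oplus> s \<otimes> star s"
  have p: "p \<in> self_adjoint" and q: "q \<in> self_adjoint"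
    using s by (auto simp: p_def q_def m_comm a_comm)
  have lt: "\<psi> p < \<psi> q"
  proof (rule ccontr)
    assume "\<not> \<psi> p < \<psi> q"
    then have "0 \<le> sqrt (\<psi> p - \<psi> q)" by simp
    then obtain w where w: "w \<in> self_adjoint" "\<psi> w = sqrt (\<psi> p - \<psi> q)"
      using psi_surj by blast
    then have ww: "w \<otimes> w \<in> self_adjoint" by simp
    have "\<psi> (q \<oplus> w \<otimes> w) = \<psi> p"
      using w ww q \<open>\<not> \<psi> p < \<psi> q\<close> by (simp add: psi_add psi_mult)
    then have pq: "q \<oplus> w \<otimes> w = p" by (rule psi_eqD) (use p q ww in auto)
    \<comment> \<open>In differences, the chain says that \<open>s - star s - w\<close> times
      \<open>s - star s + w\<close> vanishes.\<close>
    have "s \<otimes> (s \<oplus> w) \<oplus> (star s \<oplus> w) \<otimes> star s = p \<oplus> (s \<otimes> w \<oplus> star s \<otimes> w)"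
      using s w by (simp add: p_def l_distr r_distr m_ac a_ac)
    also have "\<dots> = s \<otimes> star s \<oplus> (star s \<oplus> w) \<otimes> (s \<oplus> w)"
      unfolding pq[symmetric] using s w by (simp add: q_def l_distr r_distr m_ac a_ac)
    finally have "s = star s \<oplus> w \<or> s \<oplus> w = star s"
      by (rule no_zero_divisor_differences) (use s w in auto)
    \<comment> \<open>\<open>star\<close> exchanges the two alternatives, so both hold and
      \<open>w \<oplus> w\<close> vanishes.\<close>
    moreover have "star (star s \<oplus> w) = s \<oplus> w" "star (s \<oplus> w) = star s \<oplus> w"
      using s(1) w(1) by simp_all
    ultimately have sw: "s \<oplus> w = star s" "star s \<oplus> w = s"
      using star_star[OF s(1)] by metis+
    have "s \<oplus> (w \<oplus> w) = (s \<oplus> w) \<oplus> w" using s w by (simp add: a_assoc)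
    also have "\<dots> = s \<oplus> \<zero>" unfolding sw using s by simp
    finally have "s \<oplus> (w \<oplus> w) = s \<oplus> \<zero>" .
    then have "w \<oplus> w = \<zero>" by (rule add_left_cancel) (use s w in auto)
    then have "w = \<zero>" using double_cancel[of w \<zero>] w by simp
    then show False using sw s by simp
  qed
  then obtain w where w: "w \<in> self_adjoint" "\<psi> w = sqrt (\<psi> q - \<psi> p)"
    using psi_surj[of "sqrt (\<psi> q - \<psi> p)"] by auto
  then have ww: "w \<otimes> w \<in> self_adjoint" by simp
  have "\<psi> (p \<oplus> w \<otimes> w) = \<psi> q"
    using w ww p lt by (simp add: psi_add psi_mult)
  then have "p \<oplus> w \<otimes> w = q" by (rule psi_eqD) (use p q ww in auto)
  moreover have "w \<noteq> \<zero>" using w lt by auto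
  ultimately show ?thesis using that w by (simp add: p_def q_def)
qed

text \<open>Normalising \<open>s\<close> by \<open>w\<close>, the difference \<open>a - a\<^sup>*\<close> becomes a square root of \<open>-1\<close>.\<close>

lemma imaginary_unit_exists:
  assumes s: "s \<in> carrier R" "star s \<noteq> s"
  obtains a where "a \<in> carrier R" "star a \<noteq> a"
    "a \<otimes> star a \<oplus> a \<otimes> star a = a \<otimes> a \<oplus> star a \<otimes> star a \<oplus> \<one>"
proof -
  obtain w where w: "w \<in> self_adjoint" "w \<noteq> \<zero>"
    "s \<otimes> s \<oplus> star s \<otimes> star s \<oplus> w \<otimes> w = s \<otimes> star s \<oplus> s \<otimes> star s"
    using s by (rule anti_self_adjoint_square)
  obtain v where v: "v \<in> self_adjoint" "w \<otimes> v = \<one>"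
    using w(1,2) by (rule self_adjoint_inverse)
  have v0: "v \<noteq> \<zero>" using v w zero_neq_one by auto
  have wv: "w \<otimes> w \<otimes> (v \<otimes> v) = \<one>"
  proof -
    have "w \<otimes> w \<otimes> (v \<otimes> v) = (w \<otimes> v) \<otimes> (w \<otimes> v)" using v(1) w(1) by (simp add: m_ac)
    then show ?thesis using v by simp
  qed
  show ?thesis
  proof (rule that[of "s \<otimes> v"])
    show "star (s \<otimes> v) \<noteq> s \<otimes> v"
    proof
      assume "star (s \<otimes> v) = s \<otimes> v"
      then have "v \<otimes> star s = v \<otimes> s" using s v by (simp add: m_comm)
      then have "star s = s" by (rule mult_left_cancel) (use s v v0 in auto)
      then show False using s by simp
    qed
    have "(s \<otimes> star s \<oplus> s \<otimes> star s) \<otimes> (v \<otimes> v)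
        = (s \<otimes> s \<oplus> star s \<otimes> star s) \<otimes> (v \<otimes> v) \<oplus> w \<otimes> w \<otimes> (v \<otimes> v)"
      unfolding w(3)[symmetric] using s v(1) w(1) by (simp add: l_distr)
    then show "s \<otimes> v \<otimes> star (s \<otimes> v) \<oplus> s \<otimes> v \<otimes> star (s \<otimes> v)
        = s \<otimes> v \<otimes> (s \<otimes> v) \<oplus> star (s \<otimes> v) \<otimes> star (s \<otimes> v) \<oplus> \<one>"
      unfolding wv using s v(1) by (simp add: l_distr r_distr m_ac)
  qed (use s v in auto)
qed

end

text \<open>Writing \<open>j = a - a\<^sup>*\<close>, an element of the difference ring is \<open>(x + j y) / 2\<close> with the
  self-adjoint \<open>x = s + s\<^sup>*\<close> and \<open>y = - j (s - s\<^sup>*)\<close>.  The latter is split into its positive and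
  negative terms \<open>im_pos s\<close> and \<open>im_neg s\<close>.\<close>

locale imaginary_unit = involutive_semifield_over_reals +
  fixes a :: 'a
  assumes a_closed [simp]: "a \<in> carrier R"
    and a_not_self_adjoint: "star a \<noteq> a"
    and a_square: "a \<otimes> star a \<oplus> a \<otimes> star a = a \<otimes> a \<oplus> star a \<otimes> star a \<oplus> \<one>"
begin

definition re :: "'a \<Rightarrow> 'a" where
  "re s = s \<oplus> star s"

definition im_pos :: "'a \<Rightarrow> 'a" where
  "im_pos s = star a \<otimes> s \<oplus> a \<otimes> star s"

definition im_neg :: "'a \<Rightarrow> 'a" where
  "im_neg s = a \<otimes> s \<oplus> star a \<otimes> star s"

definition to_complex :: "'a \<Rightarrow> complex" where
  "to_complex s = Complex (\<psi> (re s) / 2) ((\<psi> (im_pos s) - \<psi> (im_neg s)) / 2)"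

lemma parts_self_adjoint:
  assumes "s \<in> carrier R"
  shows "re s \<in> self_adjoint" "im_pos s \<in> self_adjoint" "im_neg s \<in> self_adjoint"
  using assms by (auto simp: re_def im_pos_def im_neg_def a_comm)

lemma to_complex_add:
  assumes "s \<in> carrier R" "t \<in> carrier R"
  shows "to_complex (s \<oplus> t) = to_complex s + to_complex t"
proof -
  have "re (s \<oplus> t) = re s \<oplus> re t" "im_pos (s \<oplus> t) = im_pos s \<oplus> im_pos t"
    "im_neg (s \<oplus> t) = im_neg s \<oplus> im_neg t"
    using assms by (simp_all add: re_def im_pos_def im_neg_def r_distr a_ac)
  then show ?thesis
    using parts_self_adjoint[OF assms(1)] parts_self_adjoint[OF assms(2)]
    by (simp add: to_complex_def psi_add complex_eq_iff field_simps)
qed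

text \<open>With \<open>x\<close> and \<open>y\<close> the real and imaginary parts before halving,
  the product rule is \<open>x_s x_t - y_s y_t = 2 x_st\<close> and
  \<open>x_s y_t + y_s x_t = 2 y_st\<close>. The facts \<open>re\<close> and \<open>im\<close> are
  these with negative terms moved across; \<open>a_square\<close> enters in the first.\<close>

lemma to_complex_mult:
  assumes st: "s \<in> carrier R" "t \<in> carrier R"
  shows "to_complex (s \<otimes> t) = to_complex s * to_complex t"
proof -
  define s' t' a' where "s' = star s" "t' = star t" "a' = star a"
  note stars = this
  have c: "s' \<in> carrier R" "t' \<in> carrier R" "a' \<in> carrier R" using st by (simp_all add: stars)
  \<comment> \<open>\<open>u - v\<close> is the product of \<open>s - star s\<close> and
    \<open>t - star t\<close>, and \<open>Q - N\<close> is the square of \<open>a - star a\<close>,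
    that is, minus one.\<close>
  define u v Q N where "u = s \<otimes> t \<oplus> s' \<otimes> t'" "v = s \<otimes> t' \<oplus> s' \<otimes> t"
    "Q = a \<otimes> a \<oplus> a' \<otimes> a'" "N = a \<otimes> a' \<oplus> a \<otimes> a'"
  note defs = this
  have uc: "u \<in> carrier R" "v \<in> carrier R" "Q \<in> carrier R" "N \<in> carrier R"
    using st c by (simp_all add: defs)
  have N: "N = Q \<oplus> \<one>" using a_square by (simp add: defs stars)
  note parts = parts_self_adjoint[OF st(1)] parts_self_adjoint[OF st(2)]
    parts_self_adjoint[OF m_closed[OF st]]
  note pc = parts[THEN CollectD, THEN conjunct1]
  have eqs: "re s = s \<oplus> s'" "re t = t \<oplus> t'" "re (s \<otimes> t) = u"
    "im_pos s = a' \<otimes> s \<oplus> a \<otimes> s'" "im_neg s = a \<otimes> s \<oplus> a' \<otimes> s'"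
    "im_pos t = a' \<otimes> t \<oplus> a \<otimes> t'" "im_neg t = a \<otimes> t \<oplus> a' \<otimes> t'"
    "im_pos (s \<otimes> t) = a' \<otimes> (s \<otimes> t) \<oplus> a \<otimes> (s' \<otimes> t')"
    "im_neg (s \<otimes> t) = a \<otimes> (s \<otimes> t) \<oplus> a' \<otimes> (s' \<otimes> t')"
    using st by (simp_all add: re_def im_pos_def im_neg_def defs stars)
  have 1: "re s \<otimes> re t = u \<oplus> v"
    unfolding eqs defs using st c by (simp add: l_distr r_distr a_ac)
  have 2: "im_pos s \<otimes> im_pos t \<oplus> im_neg s \<otimes> im_neg t = Q \<otimes> u \<oplus> N \<otimes> v"
    unfolding eqs defs using st c by (simp add: l_distr r_distr a_ac m_ac)
  have 3: "im_pos s \<otimes> im_neg t \<oplus> im_neg s \<otimes> im_pos t = N \<otimes> u \<oplus> Q \<otimes> v"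
    unfolding eqs defs using st c by (simp add: l_distr r_distr a_ac m_ac)
  have re: "re s \<otimes> re t \<oplus> (im_pos s \<otimes> im_neg t \<oplus> im_neg s \<otimes> im_pos t)
      = (re (s \<otimes> t) \<oplus> re (s \<otimes> t)) \<oplus> (im_pos s \<otimes> im_pos t \<oplus> im_neg s \<otimes> im_neg t)"
    unfolding 1 2 3 unfolding eqs(3) N using uc by (simp add: l_distr a_ac)
  have im: "re s \<otimes> im_pos t \<oplus> im_pos s \<otimes> re t \<oplus> (im_neg (s \<otimes> t) \<oplus> im_neg (s \<otimes> t))
      = re s \<otimes> im_neg t \<oplus> im_neg s \<otimes> re t \<oplus> (im_pos (s \<otimes> t) \<oplus> im_pos (s \<otimes> t))"
    unfolding eqs using st c by (simp add: l_distr r_distr a_ac m_ac)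
  have m: "x \<otimes> y \<in> self_adjoint" "x \<oplus> y \<in> self_adjoint"
    if "x \<in> self_adjoint" "y \<in> self_adjoint" for x y
    using that by auto
  have re': "\<psi> (re s) * \<psi> (re t) + (\<psi> (im_pos s) * \<psi> (im_neg t) + \<psi> (im_neg s) * \<psi> (im_pos t))
      = (\<psi> (re (s \<otimes> t)) + \<psi> (re (s \<otimes> t)))
        + (\<psi> (im_pos s) * \<psi> (im_pos t) + \<psi> (im_neg s) * \<psi> (im_neg t))"
    using arg_cong[OF re, of \<psi>] parts by (simp only: psi_add psi_mult m)
  have im': "\<psi> (re s) * \<psi> (im_pos t) + \<psi> (im_pos s) * \<psi> (re t)
        + (\<psi> (im_neg (s \<otimes> t)) + \<psi> (im_neg (s \<otimes> t)))
      = \<psi> (re s) * \<psi> (im_neg t) + \<psi> (im_neg s) * \<psi> (re t)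
        + (\<psi> (im_pos (s \<otimes> t)) + \<psi> (im_pos (s \<otimes> t)))"
    using arg_cong[OF im, of \<psi>] parts by (simp only: psi_add psi_mult m)
  show ?thesis
    using re' im' by (simp add: to_complex_def complex_eq_iff field_simps)
qed

lemma to_complex_star:
  assumes "s \<in> carrier R"
  shows "to_complex (star s) = cnj (to_complex s)"
proof -
  have "re (star s) = re s" "im_pos (star s) = im_neg s" "im_neg (star s) = im_pos s"
    using assms by (simp_all add: re_def im_pos_def im_neg_def a_comm)
  then show ?thesis by (simp add: to_complex_def complex_eq_iff field_simps)
qed

lemma to_complex_self_adjoint:
  assumes "s \<in> self_adjoint"
  shows "to_complex s = complex_of_real (\<psi> s)"
proof -
  have "im_pos s = im_neg s" using assms by (simp add: im_pos_def im_neg_def a_comm)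
  then show ?thesis using assms psi_add[of s s] by (simp add: to_complex_def re_def complex_eq_iff)
qed

text \<open>Equal imaginary parts say that \<open>a - star a\<close> annihilates the difference of
  \<open>star s \<oplus> t\<close> and \<open>s \<oplus> star t\<close>. These are therefore equal,
  and with equal real parts this gives \<open>s \<oplus> s = t \<oplus> t\<close>.\<close>

lemma to_complex_inj: "inj_on to_complex (carrier R)"
proof (rule inj_onI)
  fix s t assume st: "s \<in> carrier R" "t \<in> carrier R" and eq: "to_complex s = to_complex t"
  note parts = parts_self_adjoint[OF st(1)] parts_self_adjoint[OF st(2)]
  have "\<psi> (re s) = \<psi> (re t)" using eq by (simp add: to_complex_def complex_eq_iff)
  then have re: "re s = re t" by (rule psi_eqD) (use parts in auto)
  have "\<psi> (im_pos s \<oplus> im_neg t) = \<psi> (im_neg s \<oplus> im_pos t)"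
    using eq parts by (simp add: to_complex_def complex_eq_iff psi_add field_simps)
  then have "im_pos s \<oplus> im_neg t = im_neg s \<oplus> im_pos t" by (rule psi_eqD) (use parts in auto)
  then have "a \<otimes> (star s \<oplus> t) \<oplus> star a \<otimes> (s \<oplus> star t)
      = a \<otimes> (s \<oplus> star t) \<oplus> star a \<otimes> (star s \<oplus> t)"
    using st by (simp add: im_pos_def im_neg_def r_distr a_ac)
  then have "a = star a \<or> star s \<oplus> t = s \<oplus> star t"
    by (rule no_zero_divisor_differences) (use st in auto)
  then have eq2: "star s \<oplus> t = s \<oplus> star t" using a_not_self_adjoint by auto
  have "(s \<oplus> s) \<oplus> star t = s \<oplus> (s \<oplus> star t)" using st by (simp add: a_assoc)
  also have "\<dots> = re s \<oplus> t" unfolding eq2[symmetric] using st by (simp add: re_def a_assoc)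
  also have "\<dots> = (t \<oplus> t) \<oplus> star t" unfolding re using st by (simp add: re_def a_ac)
  finally have "s \<oplus> s = t \<oplus> t" by (rule add_cancel) (use st in auto)
  then show "s = t" using st by (rule double_cancel)
qed

lemma to_complex_embedding: "involutive_embedding_into_complex R star to_complex"
  unfolding involutive_embedding_into_complex_def
  using to_complex_inj to_complex_add to_complex_mult to_complex_star
    to_complex_self_adjoint[of \<zero>] to_complex_self_adjoint[of \<one>]
  by simp

end

lemma (in involutive_semifield_over_reals) complex_embedding_exists:
  "\<exists>\<phi>. involutive_embedding_into_complex R star \<phi>"
proof (cases "\<exists>s\<in>carrier R. star s \<noteq> s")
  case True
  then obtain s where "s \<in> carrier R" "star s \<noteq> s" by blast
  then obtain a where "a \<in> carrier R" "star a \<noteq> a"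
    "a \<otimes> star a \<oplus> a \<otimes> star a = a \<otimes> a \<oplus> star a \<otimes> star a \<oplus> \<one>"
    by (rule imaginary_unit_exists)
  then interpret imaginary_unit R star \<psi> a by unfold_locales
  show ?thesis using to_complex_embedding by blast
next
  case False
  then have sa: "star s = s" if "s \<in> carrier R" for s using that by blast
  have "inj_on (\<lambda>a. complex_of_real (\<psi> a)) (carrier R)"
    by (rule inj_onI, rule psi_eqD) (simp_all add: sa)
  then have "involutive_embedding_into_complex R star (\<lambda>a. complex_of_real (\<psi> a))"
    unfolding involutive_embedding_into_complex_def by (simp add: sa psi_add psi_mult)
  then show ?thesis by blast
qed

lemma (in involutive_semifield) complex_embedding_exists:
  assumes "dedekind_complete (R\<lparr>carrier := self_adjoint\<rparr>)"
  shows "\<exists>\<phi>. involutive_embedding_into_complex R star \<phi>"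
proof -
  obtain leq where leq: "semiring_order (R\<lparr>carrier := self_adjoint\<rparr>) leq"
    "translation_bounded_complete (R\<lparr>carrier := self_adjoint\<rparr>) leq"
    "translation_bounded_complete (R\<lparr>carrier := self_adjoint\<rparr>) (leq\<inverse>)"
    using assms by (auto simp: dedekind_complete_def)
  interpret K: complete_ordered_semifield "R\<lparr>carrier := self_adjoint\<rparr>" leq
    using cancel_semifield_self_adjoint leq
    by (intro complete_ordered_semifield.intro complete_ordered_semifield_axioms.intro)
  obtain \<psi> :: "'a \<Rightarrow> real" where "inj_on \<psi> self_adjoint" "\<psi> \<zero> = 0" "\<psi> \<one> = 1"
    "\<forall>x\<in>self_adjoint. \<forall>y\<in>self_adjoint. \<psi> (x \<oplus> y) = \<psi> x + \<psi> y \<and> \<psi> (x \<otimes> y) = \<psi> x * \<psi> y"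
    "\<forall>r\<ge>0. \<exists>x\<in>self_adjoint. \<psi> x = r"
    using K.real_embedding_exists by auto
  then interpret involutive_semifield_over_reals R star \<psi>
    by unfold_locales blast+
  show ?thesis by (rule complex_embedding_exists)
qed

section \<open>Dagger limits of two-vertex diagrams\<close>

text \<open>\<open>A\<close> labels the parallel arrows: empty for the discrete pair behind
  biproducts, \<open>{0, 1}\<close> for the parallel pair behind equalizers.\<close>

definition two_vertex_graph :: "nat set \<Rightarrow> (nat, nat) pre_digraph" where
  "two_vertex_graph A = \<lparr>verts = {0, 1}, arcs = A, tail = \<lambda>_. 0, head = \<lambda>_. 1\<rparr>"

lemma vwalk_cases:
  assumes "vwalk p K" "arcs_ends K \<subseteq> {(0, 1)}" "verts K \<subseteq> {0, 1 :: nat}"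
  shows "p \<in> {[0], [1], [0, 1]}"
proof (cases p rule: vwalk_arcs.cases)
  case (3 x y xs)
  then show ?thesis using assms by (cases xs) (auto simp: vwalk_def)
qed (use assms in \<open>auto simp: vwalk_def\<close>)

text \<open>A component without arcs is a single vertex, its own root; one with an arc contains both
  vertices and has root 1. Parallel arcs yield the same vertex walk.\<close>

lemma forest_shaped_two_vertex_graph:
  assumes "finite A"
  shows "forest_shaped (two_vertex_graph A)"
  unfolding forest_shaped_def
proof (intro conjI allI impI)
  show "fin_digraph (two_vertex_graph A)"
    using assms by unfold_locales (auto simp: two_vertex_graph_def)
next
  fix K :: "(nat, nat) pre_digraph"
  assume "pre_digraph.max_subgraph (two_vertex_graph A) Digraph_Component.connected K"
  then have sub: "subgraph K (two_vertex_graph A)" and con: "Digraph_Component.connected K"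
    by (auto simp: pre_digraph.max_subgraph_def)
  then interpret K: wf_digraph K by (simp add: subgraph_def)
  have ends: "tail K = (\<lambda>_. 0)" "head K = (\<lambda>_. 1)"
    using sub by (auto simp: subgraph_def compatible_def two_vertex_graph_def)
  have verts: "verts K \<subseteq> {0, 1}" using sub by (auto simp: subgraph_def two_vertex_graph_def)
  have arcs: "arcs_ends K \<subseteq> {(0, 1)}" by (auto simp: arcs_ends_def arc_to_ends_def ends)
  note cases = vwalk_cases[OF _ arcs verts]
  show "in_tree K"
  proof (cases "arcs K = {}")
    case True
    then have ae: "arcs_ends K = {}" by (simp add: arcs_ends_def)
    have ae': "arcs_ends (with_proj (mk_symmetric K)) = {}"
      using True by (auto simp: parcs_mk_symmetric arcs_ends_def)
    have eq: "u = v" if "u \<in> verts K" "v \<in> verts K" for u v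
    proof -
      have "u \<rightarrow>\<^sup>*\<^bsub>with_proj (mk_symmetric K)\<^esub> v"
        using con that unfolding connected_def strongly_connected_def by simp
      then show ?thesis unfolding reachable_def ae' by (induction rule: rtrancl_on.induct) auto
    qed
    obtain r where r: "r \<in> verts K"
      using con unfolding connected_def strongly_connected_def by auto
    have "\<exists>!p. vwalk p K \<and> hd p = r \<and> last p = r"
    proof (rule ex1I[of _ "[r]"])
      show "vwalk [r] K \<and> hd [r] = r \<and> last [r] = r" using r by (simp add: vwalk_def)
      show "p = [r]" if "vwalk p K \<and> hd p = r \<and> last p = r" for p
        using that cases[of p] by auto
    qed
    then show ?thesis unfolding in_tree_def using r eq by metis
  next
    case False
    then obtain e where e: "e \<in> arcs K" by blast
    then have v: "0 \<in> verts K" "1 \<in> verts K"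
      using K.tail_in_verts[OF e] K.head_in_verts[OF e] by (simp_all add: ends)
    have ae: "(0, 1) \<in> arcs_ends K" using e by (force simp: arcs_ends_def arc_to_ends_def ends)
    have from_0: "\<exists>!p. vwalk p K \<and> hd p = 0 \<and> last p = 1"
    proof (rule ex1I[of _ "[0, 1]"])
      show "vwalk [0, 1] K \<and> hd [0, 1] = 0 \<and> last [0, 1] = 1" using v ae by (simp add: vwalk_def)
      show "p = [0, 1]" if "vwalk p K \<and> hd p = 0 \<and> last p = 1" for p
        using that cases[of p] by auto
    qed
    have from_1: "\<exists>!p. vwalk p K \<and> hd p = 1 \<and> last p = 1"
    proof (rule ex1I[of _ "[1]"])
      show "vwalk [1] K \<and> hd [1] = 1 \<and> last [1] = 1" using v by (simp add: vwalk_def)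
      show "p = [1]" if "vwalk p K \<and> hd p = 1 \<and> last p = 1" for p
        using that cases[of p] by auto
    qed
    have "\<forall>v\<in>verts K. \<exists>!p. vwalk p K \<and> hd p = v \<and> last p = 1"
    proof
      fix v assume "v \<in> verts K"
      then have "v = 0 \<or> v = 1" using verts by blast
      then show "\<exists>!p. vwalk p K \<and> hd p = v \<and> last p = 1"
        by (elim disjE) (simp_all only: from_0 from_1)
    qed
    then show ?thesis unfolding in_tree_def by (rule bexI[OF _ v(2)])
  qed
qed

lemma awalk_two_vertex_graph:
  "pre_digraph.awalk (two_vertex_graph A) u p v \<longleftrightarrow>
    (p = [] \<and> u = v \<and> u \<in> {0, 1}) \<or> (\<exists>e\<in>A. p = [e] \<and> u = 0 \<and> v = 1)"
proof (cases p)
  case Nil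
  then show ?thesis by (auto simp: pre_digraph.awalk_def pre_digraph.cas.simps two_vertex_graph_def)
next
  case (Cons e es)
  then show ?thesis
    by (cases es) (auto simp: pre_digraph.awalk_def pre_digraph.cas.simps two_vertex_graph_def)
qed

lemma free_category_two_vertex_graph:
  "obj (free_category (two_vertex_graph A)) = {0, 1}"
  "arr (free_category (two_vertex_graph A))
    = {(0, [], 0), (1, [], 1)} \<union> (\<lambda>e. (0, [e], 1)) ` A"
  "source (free_category G) (u, p, v) = u"
  "target (free_category G) (u, p, v) = v"
  "ident (free_category G) u = (u, [], u)"
  "seqcomp (free_category G) (u, p, v) (v', p', w) = (u, p @ p', w)"
  by (auto simp: free_category_def awalk_two_vertex_graph) (simp add: two_vertex_graph_def)+

text \<open>Vertex 1 stops being a leaf once an arrow points to it. So the dagger condition has two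
  terms for biproducts, but for equalizers only the one of the equalizing arrow.\<close>

lemma leaves_two_vertex_graph:
  "leaves (free_category (two_vertex_graph A)) = (if A = {} then {0, 1} else {0})"
  by (auto simp: leaves_def free_category_two_vertex_graph)

text \<open>Walks in this graph have at most one arc, so the rest of the list is ignored.\<close>

definition arrow_map :: "('o, 'm, 'z) category_scheme \<Rightarrow> (nat \<Rightarrow> 'o) \<Rightarrow> (nat \<Rightarrow> 'm)
    \<Rightarrow> nat \<times> nat list \<times> nat \<Rightarrow> 'm" where
  "arrow_map C Fo f = (\<lambda>(u, p, v). case p of [] \<Rightarrow> ident C (Fo u) | e # _ \<Rightarrow> f e)"

lemma arrow_map_simps:
  "arrow_map C Fo f (u, [], v) = ident C (Fo u)"
  "arrow_map C Fo f (u, e # p, v) = f e"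
  by (simp_all add: arrow_map_def)

context category
begin

lemma is_functor_arrow_map:
  assumes "Fo 0 \<in> obj C" "Fo 1 \<in> obj C" "\<And>e. e \<in> A \<Longrightarrow> f e \<in> homset C (Fo 0) (Fo 1)"
  shows "is_functor (free_category (two_vertex_graph A)) C Fo (arrow_map C Fo f)"
proof -
  have "ident C (Fo 0) \<Zsemi> f e = f e" "f e \<Zsemi> ident C (Fo 1) = f e" if "e \<in> A" for e
    using ident_left ident_right assms(3)[OF that] by blast+
  then show ?thesis
    using assms by (auto simp: is_functor_def free_category_two_vertex_graph arrow_map_simps
        ident_homset ident_left[OF ident_homset])
qed

lemma is_cone_arrow_map:
  "is_cone (free_category (two_vertex_graph A)) C Fo (arrow_map C Fo f) L l \<longleftrightarrow>
    L \<in> obj C \<and> l 0 \<in> homset C L (Fo 0) \<and> l 1 \<in> homset C L (Fo 1) \<and> (\<forall>e\<in>A. l 0 \<Zsemi> f e = l 1)"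
  by (auto simp: is_cone_def free_category_two_vertex_graph arrow_map_simps ident_right)

end

lemma dagger_limit_two_vertex_graph:
  fixes C :: "('o, 'm, 'z) cmon_dagger_category_scheme" (structure)
  assumes "category C" "has_finite_dagger_limits C" "finite (A :: nat set)" "X \<in> obj C" "Y \<in> obj C"
    and "\<And>e. e \<in> A \<Longrightarrow> f e \<in> homset C X Y"
  obtains L l where "l 0 \<in> homset C L X" "l 1 \<in> homset C L Y"
    "\<And>e. e \<in> A \<Longrightarrow> l 0 \<Zsemi> f e = l 1"
    "\<And>M m n. \<lbrakk>m \<in> homset C M X; n \<in> homset C M Y; \<And>e. e \<in> A \<Longrightarrow> m \<Zsemi> f e = n\<rbrakk>
      \<Longrightarrow> \<exists>u\<in>homset C M L. u \<Zsemi> l 0 = m \<and> u \<Zsemi> l 1 = n"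
    "finprod (hom_monoid C L L) (\<lambda>S::nat. l S \<Zsemi> dagger C (l S)) (if A = {} then {0, 1} else {0})
      = ident C L"
proof -
  interpret category C by fact
  define Fo where "Fo = (\<lambda>n::nat. if n = 0 then X else Y)"
  have "is_functor (free_category (two_vertex_graph A)) C Fo (arrow_map C Fo f)"
    by (rule is_functor_arrow_map) (use assms in \<open>auto simp: Fo_def\<close>)
  then obtain L l
    where "is_dagger_limit (free_category (two_vertex_graph A)) C Fo (arrow_map C Fo f) L l"
    using assms(2) forest_shaped_two_vertex_graph[OF assms(3)]
    unfolding has_finite_dagger_limits_def by blast
  then have lim: "is_limit (free_category (two_vertex_graph A)) C Fo (arrow_map C Fo f) L l"
    and sum: "finprod (hom_monoid C L L) (\<lambda>S. l S \<Zsemi> dagger C (l S))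
      (if A = {} then {0, 1} else {0}) = ident C L"
    by (auto simp: is_dagger_limit_def leaves_two_vertex_graph)
  have cone: "is_cone (free_category (two_vertex_graph A)) C Fo (arrow_map C Fo f) L l"
    using lim by (simp add: is_limit_def)
  show ?thesis
  proof (rule that)
    show "l 0 \<in> homset C L X" "l 1 \<in> homset C L Y" "\<And>e. e \<in> A \<Longrightarrow> l 0 \<Zsemi> f e = l 1"
      using cone unfolding is_cone_arrow_map by (auto simp: Fo_def)
    show "\<exists>u\<in>homset C M L. u \<Zsemi> l 0 = m \<and> u \<Zsemi> l 1 = n"
      if "m \<in> homset C M X" "n \<in> homset C M Y" "\<And>e. e \<in> A \<Longrightarrow> m \<Zsemi> f e = n" for M m n
    proof -
      have "M \<in> obj C" using that(1) source_obj by (auto simp: homset_def)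
      then have "is_cone (free_category (two_vertex_graph A)) C Fo (arrow_map C Fo f) M
          (\<lambda>S. if S = 0 then m else n)"
        unfolding is_cone_arrow_map using that by (simp add: Fo_def)
      then have "\<exists>u. u \<in> homset C M L \<and> (\<forall>S\<in>{0, 1}. u \<Zsemi> l S = (if S = 0 then m else n))"
        using lim unfolding is_limit_def free_category_two_vertex_graph by blast
      then show ?thesis by auto
    qed
  qed (rule sum)
qed

section \<open>Dagger equalizers and biproducts\<close>

context category
begin

lemma homset_iff: "f \<in> homset C A B \<longleftrightarrow> f \<in> arr C \<and> source C f = A \<and> target C f = B"
  by (auto simp: homset_def)

lemma arr_homset: "f \<in> arr C \<Longrightarrow> f \<in> homset C (source C f) (target C f)"
  by (simp add: homset_iff)

lemma ident_simps [simp]: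
  assumes "A \<in> obj C"
  shows "ident C A \<in> arr C" "source C (ident C A) = A" "target C (ident C A) = A"
  using ident_homset[OF assms] by (simp_all add: homset_iff)

lemma obj_simps [simp]:
  assumes "f \<in> arr C"
  shows "source C f \<in> obj C" "target C f \<in> obj C"
  using source_obj[OF assms] target_obj[OF assms] by simp_all

lemma seqcomp_simps [simp]:
  assumes "f \<in> arr C" "g \<in> arr C" "target C f = source C g"
  shows "f \<Zsemi> g \<in> arr C" "source C (f \<Zsemi> g) = source C f" "target C (f \<Zsemi> g) = target C g"
  using seqcomp_homset[OF arr_homset, of f g] assms
  by (simp_all add: homset_iff)

lemma ident_seqcomp [simp]: "\<lbrakk>f \<in> arr C; source C f = A\<rbrakk> \<Longrightarrow> ident C A \<Zsemi> f = f"
  using ident_left[OF arr_homset] by blast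

lemma seqcomp_ident [simp]: "\<lbrakk>f \<in> arr C; target C f = A\<rbrakk> \<Longrightarrow> f \<Zsemi> ident C A = f"
  using ident_right[OF arr_homset] by blast

lemma assoc [simp]:
  assumes "f \<in> arr C" "g \<in> arr C" "h \<in> arr C" "target C f = source C g" "target C g = source C h"
  shows "(f \<Zsemi> g) \<Zsemi> h = f \<Zsemi> (g \<Zsemi> h)"
  by (rule seqcomp_assoc[OF arr_homset]) (use assms in \<open>auto simp: homset_iff\<close>)

lemma seqcomp_reassoc:
  assumes "f \<Zsemi> g = k" "f \<in> arr C" "g \<in> arr C" "h \<in> arr C"
    "target C f = source C g" "target C g = source C h"
  shows "f \<Zsemi> (g \<Zsemi> h) = k \<Zsemi> h"
  using assms by (simp flip: assoc)

end

section \<open>Dagger, addition and the two kinds of dagger limit\<close>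

locale dagger_complete_category = dagger_category C + cmon_enriched C
  for C :: "('o, 'm, 'z) cmon_dagger_category_scheme" (structure) +
  assumes dagger_complete: "has_finite_dagger_limits C"
begin

lemma dagger_simps [simp]:
  assumes "f \<in> arr C"
  shows "dagger C f \<in> arr C" "source C (dagger C f) = target C f"
    "target C (dagger C f) = source C f" "dagger C (dagger C f) = f"
  using dagger_homset[OF arr_homset[OF assms]] dagger_dagger[OF assms] by (simp_all add: homset_iff)

lemma dagger_ident' [simp]: "A \<in> obj C \<Longrightarrow> dagger C (ident C A) = ident C A"
  by (rule dagger_ident)

lemma dagger_seqcomp' [simp]:
  assumes "f \<in> arr C" "g \<in> arr C" "target C f = source C g"
  shows "dagger C (f \<Zsemi> g) = dagger C g \<Zsemi> dagger C f"
  by (rule dagger_seqcomp[OF arr_homset]) (use assms in \<open>simp_all add: homset_iff\<close>)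

lemma zero_simps [simp]:
  assumes "A \<in> obj C" "B \<in> obj C"
  shows "hom_zero C A B \<in> arr C" "source C (hom_zero C A B) = A" "target C (hom_zero C A B) = B"
proof -
  interpret comm_monoid "hom_monoid C A B" using assms by (rule hom_comm_monoid)
  show "hom_zero C A B \<in> arr C" "source C (hom_zero C A B) = A" "target C (hom_zero C A B) = B"
    using one_closed by (simp_all add: hom_monoid_def homset_iff)
qed

lemma add_simps [simp]:
  assumes "f \<in> arr C" "g \<in> arr C" "source C f = source C g" "target C f = target C g"
  shows "f \<boxplus> g \<in> arr C" "source C (f \<boxplus> g) = source C g" "target C (f \<boxplus> g) = target C g"
proof -
  interpret comm_monoid "hom_monoid C (source C g) (target C g)"
    using assms by (simp add: hom_comm_monoid)
  show "f \<boxplus> g \<in> arr C" "source C (f \<boxplus> g) = source C g" "target C (f \<boxplus> g) = target C g"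
    using m_closed[of f g] assms by (simp_all add: hom_monoid_def homset_iff)
qed

lemma
  assumes "f \<in> arr C" "g \<in> arr C" "source C f = source C g" "target C f = target C g"
  shows add_commute: "f \<boxplus> g = g \<boxplus> f"
    and add_assoc: "\<lbrakk>h \<in> arr C; source C g = source C h; target C g = target C h\<rbrakk>
      \<Longrightarrow> (f \<boxplus> g) \<boxplus> h = f \<boxplus> (g \<boxplus> h)"
proof -
  interpret comm_monoid "hom_monoid C (source C g) (target C g)"
    using assms by (simp add: hom_comm_monoid)
  show "f \<boxplus> g = g \<boxplus> f"
    using m_comm[of f g] assms by (simp add: hom_monoid_def homset_iff)
  show "(f \<boxplus> g) \<boxplus> h = f \<boxplus> (g \<boxplus> h)"
    if "h \<in> arr C" "source C g = source C h" "target C g = target C h"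
    using m_assoc[of f g h] assms that by (simp add: hom_monoid_def homset_iff)
qed

lemma add_zero [simp]:
  assumes "f \<in> arr C" "source C f = A" "target C f = B"
  shows "f \<boxplus> hom_zero C A B = f" "hom_zero C A B \<boxplus> f = f"
proof -
  interpret comm_monoid "hom_monoid C A B"
    using assms hom_comm_monoid obj_simps by blast
  show "f \<boxplus> hom_zero C A B = f" "hom_zero C A B \<boxplus> f = f"
    using r_one[of f] l_one[of f] assms by (simp_all add: hom_monoid_def homset_iff)
qed

lemma distrib_right [simp]:
  assumes "f \<in> arr C" "g \<in> arr C" "h \<in> arr C" "source C f = source C g"
    "target C f = target C g" "target C g = source C h"
  shows "(f \<boxplus> g) \<Zsemi> h = (f \<Zsemi> h) \<boxplus> (g \<Zsemi> h)"
  by (rule add_seqcomp[OF arr_homset]) (use assms in \<open>auto simp: homset_iff\<close>)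

lemma distrib_left [simp]:
  assumes "f \<in> arr C" "g \<in> arr C" "h \<in> arr C" "source C g = source C h"
    "target C g = target C h" "target C f = source C h"
  shows "f \<Zsemi> (g \<boxplus> h) = (f \<Zsemi> g) \<boxplus> (f \<Zsemi> h)"
  by (rule seqcomp_add[OF arr_homset]) (use assms in \<open>auto simp: homset_iff\<close>)

lemma zero_seqcomp' [simp]:
  "\<lbrakk>A \<in> obj C; h \<in> arr C; source C h = B\<rbrakk> \<Longrightarrow> hom_zero C A B \<Zsemi> h = hom_zero C A (target C h)"
  using zero_seqcomp[OF _ arr_homset] by blast

lemma seqcomp_zero' [simp]:
  "\<lbrakk>D \<in> obj C; f \<in> arr C; target C f = B\<rbrakk> \<Longrightarrow> f \<Zsemi> hom_zero C B D = hom_zero C (source C f) D"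
  using seqcomp_zero[OF _ arr_homset] by blast

lemma hom_monoid_simps:
  "carrier (hom_monoid C A B) = homset C A B" "f \<otimes>\<^bsub>hom_monoid C A B\<^esub> g = f \<boxplus> g"
  "\<one>\<^bsub>hom_monoid C A B\<^esub> = hom_zero C A B"
  by (simp_all add: hom_monoid_def)

text \<open>An equalizing \<open>h\<close> factors through \<open>e\<close>, and
  \<open>e \<Zsemi> dagger C e\<close> cancels in the middle. Thus equalizing arrows are fixed
  points of one projection, with no factorising arrow to carry along.\<close>

lemma dagger_equalizer:
  assumes "f \<in> homset C A B" "g \<in> homset C A B"
  obtains E e where "e \<in> homset C E A" "e \<Zsemi> dagger C e = ident C E" "e \<Zsemi> f = e \<Zsemi> g"
    "\<And>X h. \<lbrakk>h \<in> homset C X A; h \<Zsemi> f = h \<Zsemi> g\<rbrakk> \<Longrightarrow> h \<Zsemi> (dagger C e \<Zsemi> e) = h"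
proof -
  note fg = assms[unfolded homset_iff]
  have AB: "A \<in> obj C" "B \<in> obj C" using fg obj_simps by blast+
  obtain E l where l: "l 0 \<in> homset C E A" "l 1 \<in> homset C E B"
      "\<And>e. e \<in> {0::nat, 1} \<Longrightarrow> l 0 \<Zsemi> (if e = 0 then f else g) = l 1"
    and univ: "\<And>M m n. \<lbrakk>m \<in> homset C M A; n \<in> homset C M B;
        \<And>e. e \<in> {0::nat, 1} \<Longrightarrow> m \<Zsemi> (if e = 0 then f else g) = n\<rbrakk>
      \<Longrightarrow> \<exists>u\<in>homset C M E. u \<Zsemi> l 0 = m \<and> u \<Zsemi> l 1 = n"
    and sum: "finprod (hom_monoid C E E) (\<lambda>S::nat. l S \<Zsemi> dagger C (l S))
      (if {0::nat, 1} = {} then {0, 1} else {0}) = ident C E"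
    by (rule dagger_limit_two_vertex_graph[OF category_axioms dagger_complete _ AB,
          where A = "{0, 1}" and f = "\<lambda>e. if e = 0 then f else g"]) (use assms in auto)
  have E: "E \<in> obj C" using l(1) obj_simps by (auto simp: homset_iff)
  interpret comm_monoid "hom_monoid C E E" using E by (simp add: hom_comm_monoid)
  have "l 0 \<Zsemi> dagger C (l 0) \<in> carrier (hom_monoid C E E)"
    using l(1) by (simp add: hom_monoid_simps homset_iff)
  then have ee: "l 0 \<Zsemi> dagger C (l 0) = ident C E" using sum by (simp add: finprod_insert)
  show ?thesis
  proof (rule that[OF l(1) ee])
    show "l 0 \<Zsemi> f = l 0 \<Zsemi> g" using l(3)[of 0] l(3)[of 1] by simp
    fix X h assume h: "h \<in> homset C X A" "h \<Zsemi> f = h \<Zsemi> g"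
    have "h \<Zsemi> f \<in> homset C X B" using h(1) fg by (simp add: homset_iff)
    then have "\<exists>u\<in>homset C X E. u \<Zsemi> l 0 = h \<and> u \<Zsemi> l 1 = h \<Zsemi> f"
      by (rule univ[OF h(1)]) (use h(2) in auto)
    then obtain u where u: "u \<in> homset C X E" "u \<Zsemi> l 0 = h" by blast
    have "h \<Zsemi> (dagger C (l 0) \<Zsemi> l 0) = u \<Zsemi> ((l 0 \<Zsemi> dagger C (l 0)) \<Zsemi> l 0)"
      using u(1) l(1) by (simp add: homset_iff flip: u(2))
    also have "\<dots> = h" unfolding ee using u l(1) by (simp add: homset_iff)
    finally show "h \<Zsemi> (dagger C (l 0) \<Zsemi> l 0) = h" .
  qed
qed

text \<open>The injections of the product \<open>A \<oplus> A\<close> are the daggers of the projections: composing the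
  injection \<open>u = \<langle>id, 0\<rangle>\<close> with \<open>p p\<^sup>\<dagger> + q q\<^sup>\<dagger> = id\<close> yields \<open>u = p\<^sup>\<dagger>\<close>.\<close>

lemma dagger_biproduct:
  assumes A: "A \<in> obj C"
  obtains L p q where "L \<in> obj C" "p \<in> homset C L A" "q \<in> homset C L A"
    "dagger C p \<Zsemi> p = ident C A" "dagger C p \<Zsemi> q = hom_zero C A A"
    "dagger C q \<Zsemi> p = hom_zero C A A" "dagger C q \<Zsemi> q = ident C A"
    "(p \<Zsemi> dagger C p) \<boxplus> (q \<Zsemi> dagger C q) = ident C L"
proof -
  obtain L l where l: "l 0 \<in> homset C L A" "l 1 \<in> homset C L A"
    and univ: "\<And>M m n. \<lbrakk>m \<in> homset C M A; n \<in> homset C M A;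
        \<And>e. e \<in> ({} :: nat set) \<Longrightarrow> m \<Zsemi> ident C A = n\<rbrakk>
      \<Longrightarrow> \<exists>u\<in>homset C M L. u \<Zsemi> l 0 = m \<and> u \<Zsemi> l 1 = n"
    and sum: "finprod (hom_monoid C L L) (\<lambda>S::nat. l S \<Zsemi> dagger C (l S))
      (if {} = ({} :: nat set) then {0, 1} else {0}) = ident C L"
    by (rule dagger_limit_two_vertex_graph[OF category_axioms dagger_complete _ A A,
          where A = "{}" and f = "\<lambda>_. ident C A"]) auto
  define p q where "p = l 0" "q = l 1"
  note pq = this
  have p: "p \<in> arr C" "source C p = L" "target C p = A"
    and q: "q \<in> arr C" "source C q = L" "target C q = A"
    using l by (auto simp: pq homset_iff)
  have L: "L \<in> obj C" using p obj_simps by blast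
  interpret comm_monoid "hom_monoid C L L" using L by (simp add: hom_comm_monoid)
  have "l S \<Zsemi> dagger C (l S) \<in> carrier (hom_monoid C L L)" if "S \<in> {0, 1}" for S
    using that p q by (auto simp: hom_monoid_simps homset_iff pq)
  then have sum': "(p \<Zsemi> dagger C p) \<boxplus> (q \<Zsemi> dagger C q) = ident C L"
    using sum p q by (simp add: finprod_insert hom_monoid_simps pq)
  have inj: "u = (m \<Zsemi> dagger C p) \<boxplus> (n \<Zsemi> dagger C q)"
    if "u \<in> homset C A L" "u \<Zsemi> p = m" "u \<Zsemi> q = n" for u m n
  proof -
    have "u = u \<Zsemi> ((p \<Zsemi> dagger C p) \<boxplus> (q \<Zsemi> dagger C q))"
      unfolding sum' using that(1) by (simp add: homset_iff)
    also have "\<dots> = ((u \<Zsemi> p) \<Zsemi> dagger C p) \<boxplus> ((u \<Zsemi> q) \<Zsemi> dagger C q)"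
      using that(1) p q by (simp add: homset_iff)
    finally show ?thesis by (simp add: that)
  qed
  obtain u where u: "u \<in> homset C A L" "u \<Zsemi> p = ident C A" "u \<Zsemi> q = hom_zero C A A"
    using univ[of "ident C A" A "hom_zero C A A"] A by (auto simp: homset_iff pq)
  obtain v where v: "v \<in> homset C A L" "v \<Zsemi> p = hom_zero C A A" "v \<Zsemi> q = ident C A"
    using univ[of "hom_zero C A A" A "ident C A"] A by (auto simp: homset_iff pq)
  have up: "u = dagger C p" using inj[OF u] p q A L by simp
  have vq: "v = dagger C q" using inj[OF v] p q A L by simp
  show ?thesis
    by (rule that[of L p q]) (use L p q u v sum' in \<open>auto simp: homset_iff up vq\<close>)
qed

text \<open>Dagger and enrichment are not assumed compatible. But zero is
  \<open>dagger C p \<Zsemi> q\<close>, whose dagger \<open>dagger C q \<Zsemi> p\<close> is again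
  zero.\<close>

lemma dagger_zero [simp]:
  assumes A: "A \<in> obj C"
  shows "dagger C (hom_zero C A A) = hom_zero C A A"
proof -
  obtain L p q where *: "L \<in> obj C" "p \<in> homset C L A" "q \<in> homset C L A"
    "dagger C p \<Zsemi> p = ident C A" "dagger C p \<Zsemi> q = hom_zero C A A"
    "dagger C q \<Zsemi> p = hom_zero C A A" "dagger C q \<Zsemi> q = ident C A"
    "(p \<Zsemi> dagger C p) \<boxplus> (q \<Zsemi> dagger C q) = ident C L"
    using A by (rule dagger_biproduct)
  have "dagger C (dagger C p \<Zsemi> q) = dagger C q \<Zsemi> p" using *(2,3) by (simp add: homset_iff)
  then show ?thesis using * by simp
qed

end

section \<open>Two-by-two matrices over a dagger biproduct\<close>

locale dagger_biproduct_square = dagger_complete_category C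
  for C :: "('o, 'm, 'z) cmon_dagger_category_scheme" (structure) +
  fixes A L :: 'o and p q :: 'm
  assumes objs [simp]: "A \<in> obj C" "L \<in> obj C"
    and projections: "p \<in> homset C L A" "q \<in> homset C L A"
    and pp [simp]: "dagger C p \<Zsemi> p = ident C A"
    and pq [simp]: "dagger C p \<Zsemi> q = hom_zero C A A"
    and qp [simp]: "dagger C q \<Zsemi> p = hom_zero C A A"
    and qq [simp]: "dagger C q \<Zsemi> q = ident C A"
    and sum: "(p \<Zsemi> dagger C p) \<boxplus> (q \<Zsemi> dagger C q) = ident C L"
begin

lemma projection_simps [simp]:
  "p \<in> arr C" "source C p = L" "target C p = A" "q \<in> arr C" "source C q = L" "target C q = A"
  using projections by (auto simp: homset_iff)

lemma reassoc [simp]: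
  assumes "f \<in> arr C" "source C f = A"
  shows "dagger C p \<Zsemi> (p \<Zsemi> f) = f" "dagger C p \<Zsemi> (q \<Zsemi> f) = hom_zero C A (target C f)"
    "dagger C q \<Zsemi> (p \<Zsemi> f) = hom_zero C A (target C f)" "dagger C q \<Zsemi> (q \<Zsemi> f) = f"
  using seqcomp_reassoc[OF pp, of f] seqcomp_reassoc[OF pq, of f]
    seqcomp_reassoc[OF qp, of f] seqcomp_reassoc[OF qq, of f] assms by simp_all

lemma from_square_expand:
  assumes "f \<in> arr C" "source C f = L"
  shows "f = (p \<Zsemi> (dagger C p \<Zsemi> f)) \<boxplus> (q \<Zsemi> (dagger C q \<Zsemi> f))"
proof -
  have "f = ((p \<Zsemi> dagger C p) \<boxplus> (q \<Zsemi> dagger C q)) \<Zsemi> f" unfolding sum using assms by simp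
  also have "\<dots> = (p \<Zsemi> (dagger C p \<Zsemi> f)) \<boxplus> (q \<Zsemi> (dagger C q \<Zsemi> f))" using assms by simp
  finally show ?thesis .
qed

lemma to_square_expand:
  assumes "f \<in> arr C" "target C f = L"
  shows "f = ((f \<Zsemi> p) \<Zsemi> dagger C p) \<boxplus> ((f \<Zsemi> q) \<Zsemi> dagger C q)"
proof -
  have "f = f \<Zsemi> ((p \<Zsemi> dagger C p) \<boxplus> (q \<Zsemi> dagger C q))" unfolding sum using assms by simp
  also have "\<dots> = ((f \<Zsemi> p) \<Zsemi> dagger C p) \<boxplus> ((f \<Zsemi> q) \<Zsemi> dagger C q)" using assms by simp
  finally show ?thesis .
qed

text \<open>A self-adjoint \<open>P\<close> fixing the diagonal and one injection is determined by its matrix entries,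
  so the dagger equalizer of \<open>[f, h]\<close> and \<open>[g, h]\<close> is everything.\<close>

lemma add_cancel:
  assumes "f \<in> homset C A B" "g \<in> homset C A B" "h \<in> homset C A B" and fg: "f \<boxplus> h = g \<boxplus> h"
  shows "f = g"
proof -
  note [simp] = assms(1-3)[unfolded homset_iff, THEN conjunct1]
    assms(1-3)[unfolded homset_iff, THEN conjunct2, THEN conjunct1]
    assms(1-3)[unfolded homset_iff, THEN conjunct2, THEN conjunct2]
  have [simp]: "B \<in> obj C" using obj_simps(2)[of f] by simp
  define F G where "F = (p \<Zsemi> f) \<boxplus> (q \<Zsemi> h)" "G = (p \<Zsemi> g) \<boxplus> (q \<Zsemi> h)"
  note FG = this
  have "F \<in> homset C L B" "G \<in> homset C L B" by (simp_all add: FG homset_iff)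
  then obtain E e where e: "e \<in> homset C E L" "e \<Zsemi> dagger C e = ident C E" "e \<Zsemi> F = e \<Zsemi> G"
    and eq: "\<And>X k. \<lbrakk>k \<in> homset C X L; k \<Zsemi> F = k \<Zsemi> G\<rbrakk> \<Longrightarrow> k \<Zsemi> (dagger C e \<Zsemi> e) = k"
    by (rule dagger_equalizer) (rule that)
  have [simp]: "e \<in> arr C" "source C e = E" "target C e = L" using e by (auto simp: homset_iff)
  define P where "P = dagger C e \<Zsemi> e"
  have P [simp]: "P \<in> arr C" "source C P = L" "target C P = L" "dagger C P = P"
    by (simp_all add: P_def)
  \<comment> \<open>The second injection equalizes because \<open>F\<close> and \<open>G\<close>
    both restrict to \<open>h\<close>; the diagonal does because it yields
    \<open>f \<boxplus> h\<close> and \<open>g \<boxplus> h\<close>.\<close>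
  have qP: "dagger C q \<Zsemi> P = dagger C q"
    unfolding P_def by (rule eq[of _ A]) (simp_all add: homset_iff FG)
  have "(dagger C p \<boxplus> dagger C q) \<Zsemi> P = dagger C p \<boxplus> dagger C q"
    unfolding P_def by (rule eq[of _ A]) (simp_all add: homset_iff FG fg)
  then have "((dagger C p \<boxplus> dagger C q) \<Zsemi> P) \<Zsemi> p = ident C A" by simp
  then have pPp: "(dagger C p \<Zsemi> P) \<Zsemi> p = ident C A"
    using qP seqcomp_reassoc[OF qP, of p] by simp
  \<comment> \<open>Self-adjointness of \<open>P\<close> carries the vanishing entry across the
    diagonal.\<close>
  have "(dagger C p \<Zsemi> P) \<Zsemi> q = dagger C ((dagger C q \<Zsemi> P) \<Zsemi> p)" by simp
  also have "\<dots> = hom_zero C A A" unfolding qP by simp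
  finally have pPq: "(dagger C p \<Zsemi> P) \<Zsemi> q = hom_zero C A A" .
  have pP: "dagger C p \<Zsemi> P = dagger C p"
    by (subst to_square_expand[of "dagger C p \<Zsemi> P"]) (simp_all only: pPp pPq, simp_all)
  have "f = (dagger C p \<Zsemi> P) \<Zsemi> F" unfolding pP by (simp add: FG)
  also have "\<dots> = (dagger C p \<Zsemi> P) \<Zsemi> G"
    using e(3) by (simp add: P_def FG del: distrib_left)
  also have "\<dots> = g" unfolding pP by (simp add: FG)
  finally show ?thesis .
qed

text \<open>The sum factors as the diagonal \<open>D\<close> followed by the copairing
  \<open>H\<close>. Their daggers are recovered from the components, where the dagger acts on single
  entries.\<close>

lemma dagger_add:
  assumes "f \<in> homset C A B" "g \<in> homset C A B"
  shows "dagger C (f \<boxplus> g) = dagger C f \<boxplus> dagger C g"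
proof -
  note [simp] = assms[unfolded homset_iff, THEN conjunct1]
    assms[unfolded homset_iff, THEN conjunct2, THEN conjunct1]
    assms[unfolded homset_iff, THEN conjunct2, THEN conjunct2]
  have [simp]: "B \<in> obj C" using obj_simps(2)[of f] by simp
  define D where "D = dagger C p \<boxplus> dagger C q"
  define H where "H = (p \<Zsemi> f) \<boxplus> (q \<Zsemi> g)"
  have D [simp]: "D \<in> arr C" "source C D = A" "target C D = L" by (simp_all add: D_def)
  have H [simp]: "H \<in> arr C" "source C H = L" "target C H = B" by (simp_all add: H_def)
  have "dagger C p \<Zsemi> dagger C D = dagger C (D \<Zsemi> p)" "dagger C q \<Zsemi> dagger C D = dagger C (D \<Zsemi> q)"
    by simp_all
  then have "dagger C p \<Zsemi> dagger C D = ident C A" "dagger C q \<Zsemi> dagger C D = ident C A"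
    by (simp_all add: D_def)
  then have D': "dagger C D = p \<boxplus> q"
    using from_square_expand[of "dagger C D"] by simp
  have "dagger C H \<Zsemi> p = dagger C (dagger C p \<Zsemi> H)" "dagger C H \<Zsemi> q = dagger C (dagger C q \<Zsemi> H)"
    by simp_all
  then have "dagger C H \<Zsemi> p = dagger C f" "dagger C H \<Zsemi> q = dagger C g"
    by (simp_all add: H_def)
  then have H': "dagger C H = (dagger C f \<Zsemi> dagger C p) \<boxplus> (dagger C g \<Zsemi> dagger C q)"
    using to_square_expand[of "dagger C H"] by simp
  have "f \<boxplus> g = D \<Zsemi> H" by (simp add: D_def H_def)
  then have "dagger C (f \<boxplus> g) = dagger C H \<Zsemi> dagger C D" by simp
  also have "\<dots> = dagger C f \<boxplus> dagger C g" unfolding D' H' by simp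
  finally show ?thesis .
qed

end

context dagger_biproduct_square
begin

text \<open>The dagger equalizer \<open>e\<close> of the daggers of the kernel pair \<open>(k p, k q)\<close> of \<open>r\<close> is a monomorphism
  into \<open>A\<close> through which \<open>r\<^sup>\<dagger>\<close> factors.  If \<open>e = 0\<close> then \<open>r = 0\<close>; if \<open>e\<close> is invertible then the
  kernel pair is trivial, that is, \<open>r\<close> is a monomorphism.\<close>

lemma simple_imp_inverse:
  assumes r: "r \<in> homset C A A" "r \<noteq> hom_zero C A A"
    and simple: "\<And>f. \<lbrakk>is_mono C f; target C f = A\<rbrakk> \<Longrightarrow> f = hom_zero C (source C f) A \<or> is_iso C f"
  shows "\<exists>s\<in>homset C A A. r \<Zsemi> s = ident C A"
proof -
  have [simp]: "r \<in> arr C" "source C r = A" "target C r = A" using r by (auto simp: homset_iff)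
  have "p \<Zsemi> r \<in> homset C L A" "q \<Zsemi> r \<in> homset C L A" by (simp_all add: homset_iff)
  then obtain K k where k: "k \<in> homset C K L" "k \<Zsemi> dagger C k = ident C K" "k \<Zsemi> (p \<Zsemi> r) = k \<Zsemi> (q \<Zsemi> r)"
    and kernel: "\<And>X h. \<lbrakk>h \<in> homset C X L; h \<Zsemi> (p \<Zsemi> r) = h \<Zsemi> (q \<Zsemi> r)\<rbrakk> \<Longrightarrow> h \<Zsemi> (dagger C k \<Zsemi> k) = h"
    by (rule dagger_equalizer) (rule that)
  have [simp]: "k \<in> arr C" "source C k = K" "target C k = L" using k by (auto simp: homset_iff)
  have "dagger C (k \<Zsemi> p) \<in> homset C A K" "dagger C (k \<Zsemi> q) \<in> homset C A K"
    by (simp_all add: homset_iff)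
  then obtain E e where e: "e \<in> homset C E A" "e \<Zsemi> dagger C e = ident C E"
      "e \<Zsemi> dagger C (k \<Zsemi> p) = e \<Zsemi> dagger C (k \<Zsemi> q)"
    and coker: "\<And>X h. \<lbrakk>h \<in> homset C X A; h \<Zsemi> dagger C (k \<Zsemi> p) = h \<Zsemi> dagger C (k \<Zsemi> q)\<rbrakk>
      \<Longrightarrow> h \<Zsemi> (dagger C e \<Zsemi> e) = h"
    by (rule dagger_equalizer) (rule that)
  have [simp]: "e \<in> arr C" "source C e = E" "target C e = A" using e by (auto simp: homset_iff)
  have [simp]: "E \<in> obj C" "K \<in> obj C" using obj_simps(1)[of e] obj_simps(1)[of k] by simp_all
  have "is_mono C e"
    unfolding is_mono_def
  proof (intro conjI ballI impI)
    fix X g h assume gh: "g \<in> homset C X (source C e)" "h \<in> homset C X (source C e)" "g \<Zsemi> e = h \<Zsemi> e"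
    have "g = (g \<Zsemi> e) \<Zsemi> dagger C e" using gh(1) e(2) by (simp add: homset_iff)
    also have "\<dots> = h" unfolding gh(3) using gh(2) e(2) by (simp add: homset_iff)
    finally show "g = h" .
  qed simp
  moreover have "e \<noteq> hom_zero C E A"
  proof
    assume e0: "e = hom_zero C E A"
    have "dagger C r \<Zsemi> dagger C (k \<Zsemi> p) = dagger C (k \<Zsemi> (p \<Zsemi> r))" by simp
    also have "\<dots> = dagger C r \<Zsemi> dagger C (k \<Zsemi> q)" unfolding k(3) by simp
    finally have "dagger C r \<Zsemi> (dagger C e \<Zsemi> e) = dagger C r"
      by (intro coker[of _ A]) (simp_all add: homset_iff)
    moreover have "dagger C r \<Zsemi> (dagger C e \<Zsemi> e) = (dagger C r \<Zsemi> dagger C e) \<Zsemi> e" by simp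
    moreover have "\<dots> = hom_zero C A A" by (subst (2) e0) simp
    ultimately have "dagger C r = hom_zero C A A" by simp
    then have "dagger C (dagger C r) = hom_zero C A A" by simp
    then show False using r by simp
  qed
  ultimately have "is_iso C e" using simple[of e] by simp
  then obtain i where i: "i \<in> homset C A E" "i \<Zsemi> e = ident C A"
    unfolding is_iso_def by auto
  have "dagger C (k \<Zsemi> p) = (i \<Zsemi> e) \<Zsemi> dagger C (k \<Zsemi> p)" unfolding i(2) by simp
  also have "\<dots> = i \<Zsemi> (e \<Zsemi> dagger C (k \<Zsemi> p))" by (rule assoc) (use i(1) in \<open>simp_all add: homset_iff\<close>)
  also have "\<dots> = i \<Zsemi> (e \<Zsemi> dagger C (k \<Zsemi> q))" unfolding e(3) ..
  also have "\<dots> = (i \<Zsemi> e) \<Zsemi> dagger C (k \<Zsemi> q)"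
    by (rule assoc[symmetric]) (use i(1) in \<open>simp_all add: homset_iff\<close>)
  also have "\<dots> = dagger C (k \<Zsemi> q)" unfolding i(2) by simp
  finally have "dagger C (dagger C (k \<Zsemi> p)) = dagger C (dagger C (k \<Zsemi> q))" by (rule arg_cong)
  then have kpq: "k \<Zsemi> p = k \<Zsemi> q" by simp
  have "is_mono C r"
    unfolding is_mono_def
  proof (intro conjI ballI impI)
    fix X f g assume X: "X \<in> obj C" and fg: "f \<in> homset C X (source C r)" "g \<in> homset C X (source C r)"
      "f \<Zsemi> r = g \<Zsemi> r"
    have [simp]: "f \<in> arr C" "source C f = X" "target C f = A" "g \<in> arr C" "source C g = X" "target C g = A"
      using fg by (auto simp: homset_iff)
    \<comment> \<open>\<open>h\<close> pairs \<open>f\<close> with \<open>g\<close>; since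
      \<open>f \<Zsemi> r = g \<Zsemi> r\<close>, it factors through the kernel pair, whose legs
      already agree.\<close>
    define h where "h = (f \<Zsemi> dagger C p) \<boxplus> (g \<Zsemi> dagger C q)"
    have [simp]: "h \<in> arr C" "source C h = X" "target C h = L" by (simp_all add: h_def)
    have hpq: "h \<Zsemi> p = f" "h \<Zsemi> q = g" using X by (simp_all add: h_def)
    have "h \<Zsemi> (p \<Zsemi> r) = h \<Zsemi> (q \<Zsemi> r)"
      using seqcomp_reassoc[OF hpq(1), of r] seqcomp_reassoc[OF hpq(2), of r] fg(3) by simp
    then have hk: "h \<Zsemi> (dagger C k \<Zsemi> k) = h" by (intro kernel[of _ X]) (simp_all add: homset_iff)
    have "f = (h \<Zsemi> (dagger C k \<Zsemi> k)) \<Zsemi> p" unfolding hk hpq ..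
    also have "\<dots> = h \<Zsemi> (dagger C k \<Zsemi> (k \<Zsemi> p))" by simp
    also have "\<dots> = (h \<Zsemi> (dagger C k \<Zsemi> k)) \<Zsemi> q" unfolding kpq by simp
    also have "\<dots> = g" unfolding hk hpq ..
    finally show "f = g" .
  qed simp
  then have "is_iso C r" using simple[of r] r(2) by simp
  then show ?thesis unfolding is_iso_def by auto
qed

text \<open>The matrix of the projection onto the dagger equalizer of \<open>[a, b]\<close> and \<open>[b, a]\<close>.\<close>

lemma swap_equalizer_matrix:
  assumes abcd: "a \<in> homset C A A" "b \<in> homset C A A" "c \<in> homset C A A" "d \<in> homset C A A"
    and eq: "(c \<Zsemi> a) \<boxplus> (d \<Zsemi> b) = (c \<Zsemi> b) \<boxplus> (d \<Zsemi> a)"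
  obtains x\<^sub>1\<^sub>1 x\<^sub>1\<^sub>2 x\<^sub>2\<^sub>1 x\<^sub>2\<^sub>2 where
    "x\<^sub>1\<^sub>1 \<in> homset C A A" "x\<^sub>1\<^sub>2 \<in> homset C A A" "x\<^sub>2\<^sub>1 \<in> homset C A A" "x\<^sub>2\<^sub>2 \<in> homset C A A"
    "dagger C x\<^sub>1\<^sub>1 = x\<^sub>1\<^sub>1" "dagger C x\<^sub>2\<^sub>1 = x\<^sub>1\<^sub>2"
    "x\<^sub>1\<^sub>1 \<boxplus> x\<^sub>2\<^sub>1 = ident C A" "x\<^sub>1\<^sub>2 \<boxplus> x\<^sub>2\<^sub>2 = ident C A"
    "(c \<Zsemi> x\<^sub>1\<^sub>1) \<boxplus> (d \<Zsemi> x\<^sub>2\<^sub>1) = c"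
    "(x\<^sub>1\<^sub>1 \<Zsemi> x\<^sub>1\<^sub>2) \<boxplus> (x\<^sub>1\<^sub>2 \<Zsemi> x\<^sub>2\<^sub>2) = x\<^sub>1\<^sub>2"
    "(x\<^sub>1\<^sub>1 \<Zsemi> a) \<boxplus> (x\<^sub>1\<^sub>2 \<Zsemi> b) = (x\<^sub>1\<^sub>1 \<Zsemi> b) \<boxplus> (x\<^sub>1\<^sub>2 \<Zsemi> a)"
proof -
  note [simp] = abcd[unfolded homset_iff, THEN conjunct1]
    abcd[unfolded homset_iff, THEN conjunct2, THEN conjunct1]
    abcd[unfolded homset_iff, THEN conjunct2, THEN conjunct2]
  define F G where "F = (p \<Zsemi> a) \<boxplus> (q \<Zsemi> b)" "G = (p \<Zsemi> b) \<boxplus> (q \<Zsemi> a)"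
  note FG = this
  have [simp]: "F \<in> arr C" "source C F = L" "target C F = A" "G \<in> arr C" "source C G = L" "target C G = A"
    by (simp_all add: FG)
  have "F \<in> homset C L A" "G \<in> homset C L A" by (simp_all add: homset_iff)
  then obtain E e where e: "e \<in> homset C E L" "e \<Zsemi> dagger C e = ident C E" "e \<Zsemi> F = e \<Zsemi> G"
    and univ: "\<And>X k. \<lbrakk>k \<in> homset C X L; k \<Zsemi> F = k \<Zsemi> G\<rbrakk> \<Longrightarrow> k \<Zsemi> (dagger C e \<Zsemi> e) = k"
    by (rule dagger_equalizer) (rule that)
  have [simp]: "e \<in> arr C" "source C e = E" "target C e = L" using e by (auto simp: homset_iff)
  define P where "P = dagger C e \<Zsemi> e"
  have [simp]: "P \<in> arr C" "source C P = L" "target C P = L" "dagger C P = P"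
    by (simp_all add: P_def)
  have PF: "P \<Zsemi> F = P \<Zsemi> G" using e(3) by (simp add: P_def)
  have PP: "P \<Zsemi> P = P"
    by (subst (2) P_def, rule univ[of _ L]) (use PF in \<open>simp_all add: homset_iff\<close>)
  \<comment> \<open>The diagonal equalizes because \<open>a \<boxplus> b\<close> is symmetric; this
    makes both column sums the identity.\<close>
  have D: "(dagger C p \<boxplus> dagger C q) \<Zsemi> P = dagger C p \<boxplus> dagger C q"
    unfolding P_def by (rule univ[of _ A]) (simp_all add: homset_iff FG add_commute)
  \<comment> \<open>\<open>v\<close> is the row \<open>(c, d)\<close>; that it equalizes is exactly
    \<open>eq\<close>.\<close>
  define v where "v = (c \<Zsemi> dagger C p) \<boxplus> (d \<Zsemi> dagger C q)"
  have [simp]: "v \<in> arr C" "source C v = A" "target C v = L" by (simp_all add: v_def)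
  have V: "v \<Zsemi> P = v"
    unfolding P_def by (rule univ[of _ A]) (use eq in \<open>simp_all add: homset_iff FG v_def\<close>)
  let ?x11 = "dagger C p \<Zsemi> (P \<Zsemi> p)" and ?x12 = "dagger C p \<Zsemi> (P \<Zsemi> q)"
    and ?x21 = "dagger C q \<Zsemi> (P \<Zsemi> p)" and ?x22 = "dagger C q \<Zsemi> (P \<Zsemi> q)"
  have row: "dagger C p \<Zsemi> P = (?x11 \<Zsemi> dagger C p) \<boxplus> (?x12 \<Zsemi> dagger C q)"
    using to_square_expand[of "dagger C p \<Zsemi> P"] by simp
  show ?thesis
  proof (rule that[of ?x11 ?x12 ?x21 ?x22])
    show "?x11 \<boxplus> ?x21 = ident C A" using arg_cong[OF D, of "\<lambda>x. x \<Zsemi> p"] by simp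
    show "?x12 \<boxplus> ?x22 = ident C A" using arg_cong[OF D, of "\<lambda>x. x \<Zsemi> q"] by simp
    show "(c \<Zsemi> ?x11) \<boxplus> (d \<Zsemi> ?x21) = c" using arg_cong[OF V, of "\<lambda>x. x \<Zsemi> p"] by (simp add: v_def)
    show "(?x11 \<Zsemi> ?x12) \<boxplus> (?x12 \<Zsemi> ?x22) = ?x12"
    proof -
      have "?x12 = (dagger C p \<Zsemi> P) \<Zsemi> (P \<Zsemi> q)" using seqcomp_reassoc[OF PP, of q] by simp
      also have "\<dots> = (?x11 \<Zsemi> ?x12) \<boxplus> (?x12 \<Zsemi> ?x22)" unfolding row by simp
      finally show ?thesis ..
    qed
    show "(?x11 \<Zsemi> a) \<boxplus> (?x12 \<Zsemi> b) = (?x11 \<Zsemi> b) \<boxplus> (?x12 \<Zsemi> a)"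
    proof -
      have "(dagger C p \<Zsemi> P) \<Zsemi> F = (dagger C p \<Zsemi> P) \<Zsemi> G" using PF by simp
      then show ?thesis unfolding row by (simp add: FG)
    qed
  qed (simp_all add: homset_iff)
qed

end

lemma (in dagger_complete_category) dagger_biproduct_square_exists:
  assumes "A \<in> obj C"
  obtains L p q where "dagger_biproduct_square C A L p q"
proof -
  obtain L p q where "L \<in> obj C" "p \<in> homset C L A" "q \<in> homset C L A"
    "dagger C p \<Zsemi> p = ident C A" "dagger C p \<Zsemi> q = hom_zero C A A"
    "dagger C q \<Zsemi> p = hom_zero C A A" "dagger C q \<Zsemi> q = ident C A"
    "(p \<Zsemi> dagger C p) \<boxplus> (q \<Zsemi> dagger C q) = ident C L"
    using assms by (rule dagger_biproduct)
  then have "dagger_biproduct_square C A L p q" using assms by unfold_locales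
  then show ?thesis by (rule that)
qed

section \<open>Scalars\<close>

text \<open>Eckmann-Hilton.  Since \<open>\<lambda>\<^sub>I = \<rho>\<^sub>I\<close> is not an axiom, \<open>t\<close> is replaced by its conjugate \<open>u\<close>
  under the automorphism \<open>\<lambda>\<^sub>I\<^sup>-\<^sup>1 \<rho>\<^sub>I\<close>.\<close>

lemma (in monoidal_category) scalars_commute:
  assumes s: "s \<in> homset C (unit_obj C) (unit_obj C)" and t: "t \<in> homset C (unit_obj C) (unit_obj C)"
  shows "s \<Zsemi> t = t \<Zsemi> s"
proof -
  define I where "I = unit_obj C"
  define l r where "l = left_unitor C I" "r = right_unitor C I"
  note lr = this
  have I [simp]: "I \<in> obj C" using unit_obj by (simp add: I_def)
  define II where "II = I \<otimes>\<^sub>o I"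
  have l: "l \<in> homset C II I" and r: "r \<in> homset C II I"
    using left_unitor_homset right_unitor_homset unit_obj by (auto simp: lr I_def II_def)
  obtain l' where l': "l' \<in> homset C I II" "l \<Zsemi> l' = ident C II" "l' \<Zsemi> l = ident C I"
    using left_unitor_iso[OF I] l unfolding lr(1)[symmetric] is_iso_def by (auto simp: homset_iff)
  obtain r' where r': "r' \<in> homset C I II" "r \<Zsemi> r' = ident C II" "r' \<Zsemi> r = ident C I"
    using right_unitor_iso[OF I] r unfolding lr(2)[symmetric] is_iso_def by (auto simp: homset_iff)
  note homs = l r l'(1) r'(1) s[folded I_def] t[folded I_def]
  note [simp] = homs[unfolded homset_iff, THEN conjunct1]
    homs[unfolded homset_iff, THEN conjunct2, THEN conjunct1]
    homs[unfolded homset_iff, THEN conjunct2, THEN conjunct2] l'(2,3) r'(2,3)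
  have [simp]: "l \<Zsemi> (l' \<Zsemi> f) = f" "r \<Zsemi> (r' \<Zsemi> f) = f" if "f \<in> arr C" "source C f = II" for f
    using seqcomp_reassoc[OF l'(2), of f] seqcomp_reassoc[OF r'(2), of f] that by simp_all
  have [simp]: "l' \<Zsemi> (l \<Zsemi> f) = f" "r' \<Zsemi> (r \<Zsemi> f) = f" if "f \<in> arr C" "source C f = I" for f
    using seqcomp_reassoc[OF l'(3), of f] seqcomp_reassoc[OF r'(3), of f] that by simp_all
  have [simp]: "II \<in> obj C" using obj_simps(1)[of l] by simp
  \<comment> \<open>With this \<open>u\<close>, naturality of the left unitor makes \<open>T\<close>
    equal to \<open>r \<Zsemi> (t \<Zsemi> r')\<close>, so \<open>S\<close> and \<open>T\<close> are
    the conjugates of \<open>s\<close> and \<open>t\<close> by the same isomorphism.\<close>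
  define u where "u = l' \<Zsemi> (r \<Zsemi> (t \<Zsemi> (r' \<Zsemi> l)))"
  have [simp]: "u \<in> arr C" "source C u = I" "target C u = I" by (simp_all add: u_def)
  have hom: "ident C I \<in> homset C I I" "s \<in> homset C I I" "u \<in> homset C I I"
    by (simp_all add: homset_iff)
  define S T where "S = s \<otimes>\<^sub>a ident C I" "T = ident C I \<otimes>\<^sub>a u"
  note ST = this
  have "S \<in> homset C II II" "T \<in> homset C II II"
    using tensor_homset[OF hom(2,1)] tensor_homset[OF hom(1,3)] by (simp_all add: ST II_def)
  then have [simp]: "S \<in> arr C" "source C S = II" "target C S = II"
    "T \<in> arr C" "source C T = II" "target C T = II" by (simp_all add: homset_iff)
  have comm: "S \<Zsemi> T = T \<Zsemi> S"
    using tensor_seqcomp[OF hom(2,1,1,3)] tensor_seqcomp[OF hom(1,2,3,1)] by (simp add: ST)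
  have Sr: "S \<Zsemi> r = r \<Zsemi> s" using right_unitor_natural[OF hom(2)] by (simp add: lr ST I_def)
  have Tl: "T \<Zsemi> l = l \<Zsemi> u" using left_unitor_natural[OF hom(3)] by (simp add: lr ST I_def)
  have "T = (T \<Zsemi> l) \<Zsemi> l'" by simp
  also have "\<dots> = r \<Zsemi> (t \<Zsemi> r')" unfolding Tl by (simp add: u_def)
  finally have T: "T = r \<Zsemi> (t \<Zsemi> r')" .
  have "S = (S \<Zsemi> r) \<Zsemi> r'" by simp
  also have "\<dots> = r \<Zsemi> (s \<Zsemi> r')" unfolding Sr by simp
  finally have S: "S = r \<Zsemi> (s \<Zsemi> r')" .
  have "s \<Zsemi> t = r' \<Zsemi> ((S \<Zsemi> T) \<Zsemi> r)" unfolding S T by simp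
  also have "\<dots> = t \<Zsemi> s" unfolding comm unfolding S T by simp
  finally show ?thesis .
qed

locale scalar_category = monoidal_category C + dagger_complete_category C
  for C :: "('o, 'm, 'z) monoidal_dagger_category_scheme" (structure) +
  assumes simple: "simple_unit C"
    and nontrivial: "hom_zero C (unit_obj C) (unit_obj C) \<noteq> ident C (unit_obj C)"
begin

lemma scalars_simps:
  "carrier (scalars C) = homset C (unit_obj C) (unit_obj C)"
  "\<one>\<^bsub>scalars C\<^esub> = ident C (unit_obj C)" "\<zero>\<^bsub>scalars C\<^esub> = hom_zero C (unit_obj C) (unit_obj C)"
  "f \<otimes>\<^bsub>scalars C\<^esub> g = f \<Zsemi> g" "f \<oplus>\<^bsub>scalars C\<^esub> g = f \<boxplus> g"
  by (simp_all add: scalars_def)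

lemma cancel_semifield_scalars: "cancel_semifield (scalars C)"
proof -
  note [simp] = unit_obj
  obtain L p q where "dagger_biproduct_square C (unit_obj C) L p q"
    using unit_obj by (rule dagger_biproduct_square_exists)
  then interpret dagger_biproduct_square C "unit_obj C" L p q .
  have am: "abelian_monoid (scalars C)"
    by (rule abelian_monoidI)
      (auto simp: scalars_simps homset_iff add_assoc intro: add_commute)
  have cm: "comm_monoid (scalars C)"
    by (rule comm_monoidI) (auto simp: scalars_simps homset_iff intro: scalars_commute)
  show ?thesis
  proof (rule cancel_semifield.intro)
    show "semiring (scalars C)"
      by (rule semiring.intro[OF am comm_monoid.axioms(1)[OF cm]], rule semiring_axioms.intro)
        (auto simp: scalars_simps homset_iff)
    show "cancel_semifield_axioms (scalars C)"
    proof (rule cancel_semifield_axioms.intro)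
      show "a = b" if "a \<oplus>\<^bsub>scalars C\<^esub> c = b \<oplus>\<^bsub>scalars C\<^esub> c" "a \<in> carrier (scalars C)"
        "b \<in> carrier (scalars C)" "c \<in> carrier (scalars C)" for a b c
        using add_cancel that by (simp add: scalars_simps)
      show "\<exists>b\<in>carrier (scalars C). a \<otimes>\<^bsub>scalars C\<^esub> b = \<one>\<^bsub>scalars C\<^esub>"
        if "a \<in> carrier (scalars C)" "a \<noteq> \<zero>\<^bsub>scalars C\<^esub>" for a
        using simple_imp_inverse[of a] simple that by (simp add: scalars_simps simple_unit_def)
    qed (simp add: scalars_simps nontrivial)
  qed (rule cm)
qed

text \<open>By the symmetries of the matrix \<open>(x y; y x)\<close>, where \<open>x + y = 1\<close>, idempotency gives \<open>2 x y = y\<close>.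
  So either \<open>y = 0\<close>, the projection is the identity and \<open>a = b\<close>, or \<open>x = y = 1/2\<close> and \<open>c = d\<close>.\<close>

lemma involutive_semifield_scalars: "involutive_semifield (scalars C) (dagger C)"
proof -
  note [simp] = unit_obj
  obtain L p q where "dagger_biproduct_square C (unit_obj C) L p q"
    using unit_obj by (rule dagger_biproduct_square_exists)
  then interpret dagger_biproduct_square C "unit_obj C" L p q .
  interpret S: cancel_semifield "scalars C" by (rule cancel_semifield_scalars)
  have star_add: "dagger C (a \<oplus>\<^bsub>scalars C\<^esub> b) = dagger C a \<oplus>\<^bsub>scalars C\<^esub> dagger C b"
    if "a \<in> carrier (scalars C)" "b \<in> carrier (scalars C)" for a b
    using dagger_add that by (simp add: scalars_simps)
  show ?thesis
  proof (rule involutive_semifield.intro[OF S.cancel_semifield_axioms], unfold_locales)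
    fix a b c d
    assume abcd: "a \<in> carrier (scalars C)" "b \<in> carrier (scalars C)"
      "c \<in> carrier (scalars C)" "d \<in> carrier (scalars C)"
      and eq: "a \<otimes>\<^bsub>scalars C\<^esub> c \<oplus>\<^bsub>scalars C\<^esub> b \<otimes>\<^bsub>scalars C\<^esub> d
        = a \<otimes>\<^bsub>scalars C\<^esub> d \<oplus>\<^bsub>scalars C\<^esub> b \<otimes>\<^bsub>scalars C\<^esub> c"
    note abcd' = abcd[unfolded scalars_simps]
    have "c \<otimes>\<^bsub>scalars C\<^esub> a \<oplus>\<^bsub>scalars C\<^esub> d \<otimes>\<^bsub>scalars C\<^esub> b
        = c \<otimes>\<^bsub>scalars C\<^esub> b \<oplus>\<^bsub>scalars C\<^esub> d \<otimes>\<^bsub>scalars C\<^esub> a"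
      using eq abcd by (simp add: S.m_comm S.a_comm)
    then have "(c \<Zsemi> a) \<boxplus> (d \<Zsemi> b) = (c \<Zsemi> b) \<boxplus> (d \<Zsemi> a)" by (simp add: scalars_simps)
    then obtain x y y' x' where
      "x \<in> homset C (unit_obj C) (unit_obj C)" "y \<in> homset C (unit_obj C) (unit_obj C)"
      "y' \<in> homset C (unit_obj C) (unit_obj C)" "x' \<in> homset C (unit_obj C) (unit_obj C)"
      "dagger C x = x" "dagger C y' = y"
      "x \<boxplus> y' = ident C (unit_obj C)" "y \<boxplus> x' = ident C (unit_obj C)"
      "(c \<Zsemi> x) \<boxplus> (d \<Zsemi> y') = c"
      "(x \<Zsemi> y) \<boxplus> (y \<Zsemi> x') = y"
      "(x \<Zsemi> a) \<boxplus> (y \<Zsemi> b) = (x \<Zsemi> b) \<boxplus> (y \<Zsemi> a)"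
      by (rule swap_equalizer_matrix[OF abcd'])
    note * = this[folded scalars_simps]
    note closed = *(1-4)
    \<comment> \<open>Taking the dagger of the first column sum replaces \<open>y'\<close> by
      \<open>y\<close>; cancellation then identifies \<open>y'\<close> with \<open>y\<close> and
      \<open>x'\<close> with \<open>x\<close>.\<close>
    have "x \<oplus>\<^bsub>scalars C\<^esub> y = dagger C (x \<oplus>\<^bsub>scalars C\<^esub> y')"
      using star_add[OF *(1,3)] *(5,6) by simp
    also have "\<dots> = \<one>\<^bsub>scalars C\<^esub>" unfolding *(7) by (simp add: scalars_simps)
    finally have xy: "x \<oplus>\<^bsub>scalars C\<^esub> y = \<one>\<^bsub>scalars C\<^esub>" .
    have y': "y' = y" by (rule S.add_left_cancel[of x]) (use xy * in simp_all)
    have x': "x' = x" by (rule S.add_left_cancel[of y]) (use xy * in \<open>simp_all add: S.a_comm[of y x]\<close>)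
    show "a = b \<or> c = d"
    proof (cases "y = \<zero>\<^bsub>scalars C\<^esub>")
      case True
      then have "x = \<one>\<^bsub>scalars C\<^esub>" using xy closed by simp
      then show ?thesis using *(11) True abcd by simp
    next
      case False
      have "y \<otimes>\<^bsub>scalars C\<^esub> (x \<oplus>\<^bsub>scalars C\<^esub> x) = y \<otimes>\<^bsub>scalars C\<^esub> \<one>\<^bsub>scalars C\<^esub>"
        using *(10) closed unfolding x' by (simp add: S.r_distr S.m_comm)
      then have xx: "x \<oplus>\<^bsub>scalars C\<^esub> x = \<one>\<^bsub>scalars C\<^esub>"
        by (rule S.mult_left_cancel) (use False closed in auto)
      have yx: "y = x" by (rule S.add_left_cancel[of x]) (use xy xx closed in auto)
      \<comment> \<open>With all entries one half, the fixed row \<open>(c, d)\<close> says that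
        \<open>c\<close> is half of \<open>c\<close> plus half of \<open>d\<close>.\<close>
      have "x \<otimes>\<^bsub>scalars C\<^esub> c \<oplus>\<^bsub>scalars C\<^esub> x \<otimes>\<^bsub>scalars C\<^esub> d = c"
        using *(9) closed abcd unfolding y' yx by (simp add: S.m_comm)
      also have "c = x \<otimes>\<^bsub>scalars C\<^esub> c \<oplus>\<^bsub>scalars C\<^esub> x \<otimes>\<^bsub>scalars C\<^esub> c"
        using arg_cong[OF xx, of "\<lambda>z. z \<otimes>\<^bsub>scalars C\<^esub> c"] closed abcd by (simp add: S.l_distr)
      finally have "x \<otimes>\<^bsub>scalars C\<^esub> d = x \<otimes>\<^bsub>scalars C\<^esub> c"
        by (rule S.add_left_cancel) (use closed abcd in auto)
      then have "d = c" by (rule S.mult_left_cancel) (use False yx closed abcd in auto)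
      then show ?thesis by simp
    qed
  next
    fix a b assume "a \<in> carrier (scalars C)" "b \<in> carrier (scalars C)"
    then show "dagger C (a \<otimes>\<^bsub>scalars C\<^esub> b) = dagger C a \<otimes>\<^bsub>scalars C\<^esub> dagger C b"
      using S.m_comm[of "dagger C a" "dagger C b"] by (simp add: scalars_simps homset_iff)
  qed (auto simp: star_add, auto simp: scalars_simps homset_iff)
qed

end

theorem theorem4p2:
  fixes C :: "('o, 'm) monoidal_dagger_category"
  assumes "monoidal_category C"
    and "dagger_category C"
    and "cmon_enriched C"
    and "has_finite_dagger_limits C"
    and "hom_zero C (unit_obj C) (unit_obj C) \<noteq> ident C (unit_obj C)"
    and "simple_unit C"
    and "dedekind_complete (self_adjoint_scalars C)"
  shows "\<exists>\<phi> :: 'm \<Rightarrow> complex. involutive_embedding_into_complex (scalars C) (dagger C) \<phi>"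
proof -
  have "dagger_complete_category C"
    using assms by (intro dagger_complete_category.intro dagger_complete_category_axioms.intro)
  then interpret scalar_category C
    using assms by (intro scalar_category.intro scalar_category_axioms.intro)
  interpret involutive_semifield "scalars C" "dagger C" by (rule involutive_semifield_scalars)
  have "dedekind_complete ((scalars C)\<lparr>carrier := self_adjoint\<rparr>)"
    using assms(7) by (simp add: self_adjoint_scalars_def scalars_simps)
  then show ?thesis by (rule complex_embedding_exists)
qed

end
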